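(* Let $\Bbbk$ be a field, $R=\Bbbk[x_1,\dots,x_n]$, and let $I\subsetneq R$ be a zero-dimensional ideal with $D=\dim_\Bbbk(R/I)$. Let $<_1,<_2$ be two term orders on $R$, let $\mathcal G_1$ be the reduced Gröbner basis of $I$ with respect to $<_1$, and let $M^{(1)},\dots,M^{(n)}$ be the multiplication matrices of $R/I$ with respect to the staircase of $\mathcal G_1$. Then the FGLM algorithm (described in the context) with input $\mathcal G_1$, $<_2$, $M^{(1)},\dots,M^{(n)}$ terminates, and the list $G$ it returns is a Gröbner basis of $I$ with respect to $<_2$.
   Context: A term is a monic monomial $x^\alpha$; a term order is a total order on terms compatible with multiplication for which $m_1\mid m_2$ implies $m_1\le m_2$. $\mathrm{LT}_<(f)$ is the largest term (w.r.t. $<$) occurring in $f\neq 0$. A Gröbner basis of $I$ w.r.t. $<$ is a finite subset of $I$ whose leading terms generate the ideal $\mathrm{LT}_<(I)$ generated by all leading terms of nonzero elements of $I$. An ideal is zero-dimensional if $\dim_\Bbbk(R/I)<\infty$. Staircase: $\mathcal W_{<_1}(\mathcal G_1)=\{1=w_1<_1\dots<_1 w_D\}$ is the set of terms not divisible by any $\mathrm{LT}_{<_1}(g)$, $g\in\mathcal G_1$; its classes form a $\Bbbk$-basis of $R/I$. The $k$-th multiplication matrix $M^{(k)}$ is the $D\times D$ matrix, in this basis, of the linear map $R/I\to R/I$, $\overline f\mapsto\overline{x_kf}$ (column $j$ contains the coordinates of $\overline{x_kw_j}$). Procedure Update$(P,r,\lambda)$ for $P\in\mathrm{GL}_D(\Bbbk)$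 and $\lambda\in\Bbbk^D$ having a nonzero entry among the positions $r+1,\dots,D$: let $k=\min\{i\ge r+1:\lambda_i\ne0\}$; swap rows $r+1$ and $k$ of $P$ and entries $r+1$ and $k$ of $\lambda$; divide row $r+1$ of $P$ by $\lambda_{r+1}$; for every $i\ne r+1$ replace row $i$ of $P$ by (row $i$) $-\lambda_i\cdot$(row $r+1$); return $P$. FGLM algorithm. Below, $S_l,V_l$ denote the $l$-th entries of the lists $S,V$, and a pair $(k,l)$ represents the term $x_kS_l$. Initialise $S=[1]$, $V=[(1,0,\dots,0)^T]$, $G=[\,]$, $P=$ the $D\times D$ identity matrix, and $L=[(1,1),\dots,(n,1)]$ sorted increasingly by $<_2$ of the represented terms. While $L\ne\emptyset$: remove from $L$ its first (i.e. $<_2$-smallest) element $(k,l)$; set $r=\#S$, $v=M^{(k)}V_l$, $\lambda=Pv$. If $\lambda_{r+1}=\dots=\lambda_D=0$ (vacuously true when $r=D$), append $x_kS_l-\sum_{i=1}^r\lambda_iS_i$ to $G$. Otherwise set $P:=$ Update$(P,r,\lambda)$, append $x_kS_l$ to $S$ and $v$ to $V$, and add the pairs $(i,r+1)$, $i=1,\dots,n$, to $L$, keeping $L$ sorted by $<_2$. At the end of each iteration, remove from $L$ duplicates (pairs representing the same term) and pairs representing multiples of elements of $\mathrm{LT}_{<_2}(G)$. When $L=\emptyset$, return $G$. *)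

theory Defs
  imports
    "HOL-Algebra.Algebra"
    "HOL-Library.Poly_Mapping"
    "HOL-Library.Sublist"
    "Jordan_Normal_Form.VS_Connect"
    "Jordan_Normal_Form.Gauss_Jordan_Elimination"
begin

section \<open>Terms and polynomials\<close>

text \<open>
  A term is represented by its exponent vector, so multiplication of terms is addition of
  exponents and the term 1 is 0. The variables are indexed by the finite type 'n.
\<close>

type_synonym 'n pp = "'n \<Rightarrow>\<^sub>0 nat"
type_synonym ('n, 'k) mpoly = "'n pp \<Rightarrow>\<^sub>0 'k"

abbreviation polyring :: "('n, 'k::field) mpoly ring" where
  "polyring \<equiv> class_ring"

definition var :: "'n \<Rightarrow> 'n pp" where
  "var k = Poly_Mapping.single k 1"

definition mono_poly :: "'n pp \<Rightarrow> ('n, 'k::field) mpoly" where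
  "mono_poly t = Poly_Mapping.single t 1"

definition term_dvd :: "'n pp \<Rightarrow> 'n pp \<Rightarrow> bool" where
  "term_dvd s t \<longleftrightarrow> (\<exists>u. t = s + u)"

text \<open>Term orders are given by their strict part.\<close>

definition term_order :: "('n pp \<Rightarrow> 'n pp \<Rightarrow> bool) \<Rightarrow> bool" where
  "term_order lt \<longleftrightarrow>
     class.linorder (\<lambda>s t. lt s t \<or> s = t) lt \<and>
     (\<forall>s t u. lt s t \<longrightarrow> lt (s + u) (t + u)) \<and>
     (\<forall>s t. term_dvd s t \<longrightarrow> lt s t \<or> s = t)"

definition LT :: "('n pp \<Rightarrow> 'n pp \<Rightarrow> bool) \<Rightarrow> ('n, 'k::field) mpoly \<Rightarrow> 'n pp" where
  "LT lt f = (THE t. t \<in> Poly_Mapping.keys f \<and>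
                     (\<forall>s \<in> Poly_Mapping.keys f. lt s t \<or> s = t))"

section \<open>Groebner bases\<close>

definition LT_ideal ::
    "('n pp \<Rightarrow> 'n pp \<Rightarrow> bool) \<Rightarrow> ('n, 'k::field) mpoly set \<Rightarrow> ('n, 'k) mpoly set" where
  "LT_ideal lt F = Idl\<^bsub>polyring\<^esub> {mono_poly (LT lt f) | f. f \<in> F \<and> f \<noteq> 0}"

definition groebner_basis ::
    "('n pp \<Rightarrow> 'n pp \<Rightarrow> bool) \<Rightarrow> ('n, 'k::field) mpoly set \<Rightarrow> ('n, 'k) mpoly set \<Rightarrow> bool" where
  "groebner_basis lt I G \<longleftrightarrow> finite G \<and> G \<subseteq> I \<and> LT_ideal lt G = LT_ideal lt I"

definition reduced_groebner_basis ::
    "('n pp \<Rightarrow> 'n pp \<Rightarrow> bool) \<Rightarrow> ('n, 'k::field) mpoly set \<Rightarrow> ('n, 'k) mpoly set \<Rightarrow> bool" where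
  "reduced_groebner_basis lt I G \<longleftrightarrow>
     groebner_basis lt I G \<and> 0 \<notin> G \<and>
     (\<forall>g \<in> G. Poly_Mapping.lookup g (LT lt g) = 1) \<and>
     (\<forall>g \<in> G. \<forall>h \<in> G - {g}. \<forall>t \<in> Poly_Mapping.keys g. \<not> term_dvd (LT lt h) t)"

section \<open>The quotient by an ideal\<close>

text \<open>
  The field of scalars acts on the quotient ring through the classes of constant polynomials,
  so the quotient is an algebra over the set of these classes, as in \<^theory>\<open>HOL-Algebra.Embedded_Algebras\<close>.
\<close>

definition quot_scalar :: "('n, 'k::field) mpoly set \<Rightarrow> 'k \<Rightarrow> ('n, 'k) mpoly set" where
  "quot_scalar I c = I +>\<^bsub>polyring\<^esub> (Poly_Mapping.single 0 c)"

definition zero_dimensional :: "('n, 'k::field) mpoly set \<Rightarrow> bool" where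
  "zero_dimensional I \<longleftrightarrow>
     ring.finite_dimension (polyring Quot I) (range (quot_scalar I)) (carrier (polyring Quot I))"

definition quot_dim :: "('n, 'k::field) mpoly set \<Rightarrow> nat" where
  "quot_dim I = ring.dim (polyring Quot I) (range (quot_scalar I)) (carrier (polyring Quot I))"

definition staircase ::
    "('n pp \<Rightarrow> 'n pp \<Rightarrow> bool) \<Rightarrow> ('n, 'k::field) mpoly set \<Rightarrow> 'n pp set" where
  "staircase lt G = {t. \<forall>g \<in> G. \<not> term_dvd (LT lt g) t}"

definition staircase_list ::
    "('n pp \<Rightarrow> 'n pp \<Rightarrow> bool) \<Rightarrow> ('n, 'k::field) mpoly set \<Rightarrow> 'n pp list \<Rightarrow> bool" where
  "staircase_list lt G ws \<longleftrightarrow> sorted_wrt lt ws \<and> set ws = staircase lt G"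

text \<open>
  Column j consists of the coordinates, with respect to the classes of the terms ws, of the
  image of the class of ws ! j under multiplication by the k-th variable.
\<close>

definition mult_matrix ::
    "('n, 'k::field) mpoly set \<Rightarrow> 'n pp list \<Rightarrow> 'n \<Rightarrow> 'k mat \<Rightarrow> bool" where
  "mult_matrix I ws k M \<longleftrightarrow>
     M \<in> carrier_mat (length ws) (length ws) \<and>
     (\<forall>j < length ws.
        I +>\<^bsub>polyring\<^esub> (mono_poly (var k) * mono_poly (ws ! j)) =
        (\<Oplus>\<^bsub>polyring Quot I\<^esub> i \<in> {..<length ws}.
           quot_scalar I (M $$ (i, j)) \<otimes>\<^bsub>polyring Quot I\<^esub> (I +>\<^bsub>polyring\<^esub> mono_poly (ws ! i))))"

section \<open>The FGLM algorithm\<close>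

text \<open>
  All indices start at 0: row r of a matrix is row r + 1 in the usual 1-based numbering, and a
  pair (k, l) represents the k-th variable times the entry S ! l.
\<close>

definition fglm_update :: "'k::field mat \<Rightarrow> nat \<Rightarrow> 'k vec \<Rightarrow> 'k mat" where
  "fglm_update P r lam =
     (let k = (LEAST i. r \<le> i \<and> i < dim_vec lam \<and> lam $ i \<noteq> 0);
          lam' = vec (dim_vec lam) (\<lambda>i. if i = r then lam $ k else if i = k then lam $ r else lam $ i);
          P' = multrow r (inverse (lam' $ r)) (swaprows r k P)
      in mat (dim_row P) (dim_col P)
           (\<lambda>(i, j). if i = r then P' $$ (r, j) else P' $$ (i, j) - lam' $ i * P' $$ (r, j)))"

definition pair_term :: "'n pp list \<Rightarrow> 'n \<times> nat \<Rightarrow> 'n pp" where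
  "pair_term S p = var (fst p) + S ! snd p"

definition new_pairs :: "nat \<Rightarrow> ('n::finite \<times> nat) multiset" where
  "new_pairs l = image_mset (\<lambda>i. (i, l)) (mset_set UNIV)"

text \<open>
  The informal algorithm leaves open how pairs representing the same term are ordered in L and
  which of them survives the removal of duplicates. Hence sorting and cleaning are relations,
  and the algorithm is a nondeterministic transition system admitting every such choice.
\<close>

definition sorted_arrangement ::
    "('n pp \<Rightarrow> 'n pp \<Rightarrow> bool) \<Rightarrow> 'n pp list \<Rightarrow> ('n \<times> nat) multiset \<Rightarrow> ('n \<times> nat) list \<Rightarrow> bool" where
  "sorted_arrangement lt S A L \<longleftrightarrow>
     mset L = A \<and> sorted_wrt (\<lambda>s t. lt s t \<or> s = t) (map (pair_term S) L)"

definition cleaned ::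
    "('n pp \<Rightarrow> 'n pp \<Rightarrow> bool) \<Rightarrow> 'n pp list \<Rightarrow> ('n, 'k::field) mpoly list \<Rightarrow>
     ('n \<times> nat) list \<Rightarrow> ('n \<times> nat) list \<Rightarrow> bool" where
  "cleaned lt S G L L' \<longleftrightarrow>
     subseq L' L \<and> distinct (map (pair_term S) L') \<and>
     pair_term S ` set L' = {t \<in> pair_term S ` set L. \<forall>g \<in> set G. \<not> term_dvd (LT lt g) t}"

text \<open>States consist of the lists S, V, G, the matrix P and the list L.\<close>

type_synonym ('n, 'k) fglm_state =
  "'n pp list \<times> 'k vec list \<times> ('n, 'k) mpoly list \<times> 'k mat \<times> ('n \<times> nat) list"

definition fglm_init ::
    "('n::finite pp \<Rightarrow> 'n pp \<Rightarrow> bool) \<Rightarrow> nat \<Rightarrow> ('n, 'k::field) fglm_state \<Rightarrow> bool" where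
  "fglm_init lt D st \<longleftrightarrow>
     (\<exists>L. sorted_arrangement lt [0] (new_pairs 0) L \<and>
          st = ([0], [unit_vec D 0], [], 1\<^sub>m D, L))"

text \<open>One iteration of the loop; there is no step from a state with empty L.\<close>

inductive fglm_step ::
    "('n::finite pp \<Rightarrow> 'n pp \<Rightarrow> bool) \<Rightarrow> ('n \<Rightarrow> 'k::field mat) \<Rightarrow> nat \<Rightarrow>
     ('n, 'k) fglm_state \<Rightarrow> ('n, 'k) fglm_state \<Rightarrow> bool"
  for lt M D where
  new_relation:
    "\<lbrakk> r = length S; v = M k *\<^sub>v (V ! l); lam = P *\<^sub>v v;
       \<forall>i. r \<le> i \<and> i < D \<longrightarrow> lam $ i = 0;
       G' = G @ [mono_poly (pair_term S (k, l)) - (\<Sum>i<r. Poly_Mapping.single (S ! i) (lam $ i))];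
       cleaned lt S G' L L' \<rbrakk>
     \<Longrightarrow> fglm_step lt M D (S, V, G, P, (k, l) # L) (S, V, G', P, L')"
| new_independent:
    "\<lbrakk> r = length S; v = M k *\<^sub>v (V ! l); lam = P *\<^sub>v v;
       \<exists>i. r \<le> i \<and> i < D \<and> lam $ i \<noteq> 0;
       S' = S @ [pair_term S (k, l)];
       sorted_arrangement lt S' (mset L + new_pairs r) L1;
       cleaned lt S' G L1 L' \<rbrakk>
     \<Longrightarrow> fglm_step lt M D (S, V, G, P, (k, l) # L) (S', V @ [v], G, fglm_update P r lam, L')"

text \<open>
  Termination: a run exists, no run is infinite, and a run only stops at a state with empty L.
\<close>

definition fglm_terminates ::
    "('n::finite pp \<Rightarrow> 'n pp \<Rightarrow> bool) \<Rightarrow> ('n \<Rightarrow> 'k::field mat) \<Rightarrow> nat \<Rightarrow> bool" where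
  "fglm_terminates lt M D \<longleftrightarrow>
     (\<exists>st :: ('n, 'k) fglm_state. fglm_init lt D st) \<and>
     \<not> (\<exists>\<sigma>. fglm_init lt D (\<sigma> 0) \<and> (\<forall>i. fglm_step lt M D (\<sigma> i) (\<sigma> (Suc i)))) \<and>
     (\<forall>st S V G P L. fglm_init lt D st \<and> (fglm_step lt M D)\<^sup>*\<^sup>* st (S, V, G, P, L) \<and> L \<noteq> [] \<longrightarrow>
        (\<exists>st'. fglm_step lt M D (S, V, G, P, L) st'))"

definition fglm_returns ::
    "('n::finite pp \<Rightarrow> 'n pp \<Rightarrow> bool) \<Rightarrow> ('n \<Rightarrow> 'k::field mat) \<Rightarrow> nat \<Rightarrow>
     ('n, 'k) mpoly list \<Rightarrow> bool" where
  "fglm_returns lt M D G \<longleftrightarrow>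
     (\<exists>st S V P. fglm_init lt D st \<and> (fglm_step lt M D)\<^sup>*\<^sup>* st (S, V, G, P, []))"

end

theory Submission
  imports Defs
begin

text \<open>
  Modulo I every polynomial has a coordinate vector with respect to the first staircase, and the
  algorithm performs Gaussian elimination on the coordinate vectors of terms taken in increasing
  order. P is invertible and maps the vector of the i-th entry of S to the i-th unit vector, so a
  new term depends on S exactly if the tail of lam vanishes, and then lam consists of the
  coefficients of the relation. Each iteration either enlarges S, which has at most D entries
  because of P, or shortens L. When L is empty, every product of a variable and an entry of S lies
  in S or is a multiple of a leading term of G. Hence every term reduces modulo I to a combination
  of entries of S that are not larger; as S is independent modulo I, no leading term of an element
  of I lies in S, and all of them are multiples of leading terms of G.
\<close>

section \<open>Terms\<close>

text \<open>The delicate point is a product \<open>x_i s\<close>, with \<open>s\<close> in S, that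
  is a proper multiple of some \<open>LT(g)\<close>. Multiplying the relation \<open>g\<close> by
  the whole cofactor yields terms that need not be products of a variable and an entry of S, and
  about such terms the empty queue says nothing directly. Therefore a single variable
  \<open>x_j\<close> is split off the cofactor: \<open>x_i s / x_j\<close> is again a variable times
  an entry of S. Both this quotient and the products that arise when its representative is
  multiplied by \<open>x_j\<close> are smaller than \<open>x_i s\<close>, so the induction stays
  among finitely many products. Treating terms in increasing order ensures that the treated term is
  the leading term of the relation it produces, all other terms of which lie in S. The choice of the
  surviving pair among those representing the same term is harmless: completeness of the queue is
  stated for the represented terms, and the vectors in V are tied to S by congruence modulo I
  alone.\<close>

lemma mono_poly_mult [simp]:
  "mono_poly s * (mono_poly t :: ('n, 'k::field) mpoly) = mono_poly (s + t)"
  by (simp add: mono_poly_def mult_single)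

lemma lookup_mono_poly: "Poly_Mapping.lookup (mono_poly t) s = (if s = t then 1 else 0)"
  by (auto simp: mono_poly_def lookup_single when_def)

lemma single_eq_const_mult_mono:
  "Poly_Mapping.single t c = Poly_Mapping.single 0 c * (mono_poly t :: ('n, 'k::field) mpoly)"
  by (simp add: mono_poly_def mult_single)

lemma poly_mapping_sum_single:
  "f = (\<Sum>t\<in>Poly_Mapping.keys f. Poly_Mapping.single t (Poly_Mapping.lookup f t))"
  by (rule poly_mapping_eqI)
    (auto simp: lookup_sum lookup_single when_def sum.If_cases in_keys_iff if_distrib
          cong: if_cong)

text \<open>Strong induction on the total degree, a finite sum since there are finitely many
  variables.\<close>

lemma pp_induct [case_names zero var]:
  fixes t :: "('n::finite) pp"
  assumes zero: "Q 0" and var: "\<And>i t. Q t \<Longrightarrow> Q (var i + t)"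
  shows "Q t"
proof (induction "\<Sum>i\<in>UNIV. Poly_Mapping.lookup t i" arbitrary: t rule: less_induct)
  case less
  show ?case
  proof (cases "t = 0")
    case False
    then obtain i where i: "Poly_Mapping.lookup t i > 0"
      by (metis gr0I poly_mapping_eqI lookup_zero)
    define u where "u = t - var i"
    have t: "t = var i + u"
      by (rule poly_mapping_eqI)
        (use i in \<open>auto simp: u_def lookup_add lookup_minus var_def lookup_single when_def\<close>)
    have "(\<Sum>j\<in>UNIV. Poly_Mapping.lookup t j) = 1 + (\<Sum>j\<in>UNIV. Poly_Mapping.lookup u j)"
      by (simp add: t lookup_add sum.distrib var_def lookup_single when_def)
    then have "Q u" by (intro less) simp
    then show ?thesis using var t by simp
  qed (use zero in simp)
qed

lemma pp_cases [case_names zero var]: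
  obtains "t = (0 :: ('n::finite) pp)" | i u where "t = var i + u"
  by (induction t rule: pp_induct) auto

lemma var_neq_0 [simp]: "var i \<noteq> (0 :: 'n pp)"
  by (metis lookup_single_eq lookup_zero var_def zero_neq_one)

text \<open>A variable \<open>x_j\<close> other than \<open>x_i\<close> that divides
  \<open>x_i s\<close> already divides \<open>s\<close>, as its exponent shows. This serves to split
  one variable off a cofactor in \<open>border_reducible\<close>.\<close>

lemma var_add_swap:
  fixes s :: "'n pp"
  assumes eq: "var i + s = var j + t" and "i \<noteq> j"
  obtains u where "s = var j + u" "t = var i + u"
proof
  define u where "u = s - var j"
  have "Poly_Mapping.lookup (var i + s) j = Poly_Mapping.lookup (var j + t) j" using eq by simp
  then have j: "Poly_Mapping.lookup s j \<ge> 1"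
    using \<open>i \<noteq> j\<close> by (simp add: lookup_add var_def lookup_single when_def)
  show *: "s = var j + u"
    by (rule poly_mapping_eqI)
      (use j in \<open>auto simp: u_def lookup_add lookup_minus var_def lookup_single when_def\<close>)
  from eq have "var j + (var i + u) = var j + t"
    by (simp add: * add.left_commute)
  then show "t = var i + u" by simp
qed

lemma term_dvd_refl [simp]: "term_dvd t t"
  unfolding term_dvd_def by (metis add.right_neutral)

lemma term_dvd_add: "term_dvd s t \<Longrightarrow> term_dvd s (u + t)"
  unfolding term_dvd_def by (metis add.left_commute)

section \<open>Term orders and leading terms\<close>

locale term_ord =
  fixes lt :: "'n pp \<Rightarrow> 'n pp \<Rightarrow> bool"
  assumes term_order: "term_order lt"
begin

abbreviation le where "le s t \<equiv> lt s t \<or> s = t"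

lemma linorder: "class.linorder le lt"
  using term_order unfolding term_order_def by blast

lemma lt_irrefl [simp]: "\<not> lt t t"
  using linorder.neq_iff[OF linorder] by blast

lemma lt_trans: "lt s t \<Longrightarrow> lt t u \<Longrightarrow> lt s u"
  using linorder unfolding class.linorder_def class.order_def class.preorder_def by blast

lemma lt_asym: "lt s t \<Longrightarrow> \<not> lt t s"
  using lt_trans lt_irrefl by blast

lemma le_antisym: "le s t \<Longrightarrow> le t s \<Longrightarrow> s = t"
  using lt_asym by auto

lemma lt_linear: "lt s t \<or> s = t \<or> lt t s"
  by (rule linorder.less_linear[OF linorder])

lemma add_mono: "lt s t \<Longrightarrow> lt (u + s) (u + t)"
  using term_order unfolding term_order_def by (metis add.commute)

lemma add_mono_le: "le s t \<Longrightarrow> le (u + s) (u + t)"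
  using add_mono by blast

lemma dvd_imp_le: "term_dvd s t \<Longrightarrow> le s t"
  using term_order unfolding term_order_def by blast

lemma zero_le: "le 0 t"
  by (rule dvd_imp_le) (simp add: term_dvd_def)

lemma less_var_add: "lt t (var i + t)"
  using dvd_imp_le[of t "var i + t"] term_dvd_add[OF term_dvd_refl]
  by (metis add_cancel_left_left var_neq_0)

lemma finite_has_greatest:
  assumes "finite A" "A \<noteq> {}"
  shows "\<exists>t\<in>A. \<forall>s\<in>A. le s t"
  using assms
proof (induction rule: finite_ne_induct)
  case (insert x F)
  then obtain t where t: "t \<in> F" "\<forall>s\<in>F. le s t" by blast
  consider "le x t" | "lt t x" by (metis lt_linear)
  then show ?case
    by cases (use t in \<open>auto intro: lt_trans\<close>)
qed simp

lemma LT_eqI: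
  assumes "t \<in> Poly_Mapping.keys f" "\<And>s. s \<in> Poly_Mapping.keys f \<Longrightarrow> le s t"
  shows "LT lt f = t"
  unfolding LT_def by (rule the_equality) (use assms lt_asym in blast)+

lemma LT_greatest:
  assumes "f \<noteq> 0"
  shows "LT lt f \<in> Poly_Mapping.keys f" "\<And>s. s \<in> Poly_Mapping.keys f \<Longrightarrow> le s (LT lt f)"
proof -
  have "Poly_Mapping.keys f \<noteq> {}"
    using assms by simp
  then obtain t where "t \<in> Poly_Mapping.keys f" "\<forall>s\<in>Poly_Mapping.keys f. le s t"
    using finite_has_greatest[OF finite_keys] by blast
  moreover from this have "LT lt f = t" by (intro LT_eqI) auto
  ultimately show "LT lt f \<in> Poly_Mapping.keys f" "\<And>s. s \<in> Poly_Mapping.keys f \<Longrightarrow> le s (LT lt f)"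
    by auto
qed

end

section \<open>Ideals of the polynomial ring\<close>

lemma ideal_polyringD:
  assumes "ideal I (polyring :: ('n, 'k::field) mpoly ring)"
  shows "0 \<in> I" "\<And>f g. f \<in> I \<Longrightarrow> g \<in> I \<Longrightarrow> f + g \<in> I" "\<And>f. f \<in> I \<Longrightarrow> - f \<in> I"
    "\<And>f h. f \<in> I \<Longrightarrow> h * f \<in> I"
proof -
  interpret ideal I polyring by fact
  show "0 \<in> I" using zero_closed by simp
  show "f + g \<in> I" if "f \<in> I" "g \<in> I" for f g using a_closed[OF that] by simp
  show *: "h * f \<in> I" if "f \<in> I" for f h using I_l_closed[OF that, of h] by simp
  show "- f \<in> I" if "f \<in> I" for f using *[OF that, of "-1"] by simp
qed

lemma ideal_polyringI:
  fixes I :: "('n, 'k::field) mpoly set"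
  assumes zero: "0 \<in> I" and add: "\<And>f g. f \<in> I \<Longrightarrow> g \<in> I \<Longrightarrow> f + g \<in> I"
    and mult: "\<And>f h. f \<in> I \<Longrightarrow> h * f \<in> I"
  shows "ideal I polyring"
proof (rule idealI)
  show "ring (polyring :: ('n, 'k) mpoly ring)" by (rule class_ring.ring_axioms)
  have minus: "- f \<in> I" if "f \<in> I" for f using mult[OF that, of "-1"] by simp
  show "subgroup I (add_monoid (polyring :: ('n, 'k) mpoly ring))"
  proof (rule group.subgroupI)
    show "group (add_monoid (polyring :: ('n, 'k) mpoly ring))"
      using class_ring.add.group_axioms by simp
    show "inv\<^bsub>add_monoid polyring\<^esub> f \<in> I" if "f \<in> I" for f
      using minus[OF that] class_ring_simps(8)[where 'a = "('n, 'k) mpoly"]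
      by (metis a_inv_def)
  qed (use zero add in auto)
  show "f \<otimes>\<^bsub>polyring\<^esub> h \<in> I" if "f \<in> I" for f h
    using mult[OF that, of h] by (simp add: mult.commute)
qed (use mult in auto)

text \<open>The polynomials all of whose terms are multiples of leading terms of nonzero elements of
  \<open>F\<close> form an ideal that contains the generators, hence also the ideal they
  generate.\<close>

lemma LT_ideal_keys:
  fixes p :: "('n, 'k::field) mpoly"
  assumes "p \<in> LT_ideal lt F" "t \<in> Poly_Mapping.keys p"
  shows "\<exists>f\<in>F. f \<noteq> 0 \<and> term_dvd (LT lt f) t"
proof -
  define J where
    "J = {p :: ('n, 'k) mpoly. \<forall>t\<in>Poly_Mapping.keys p. \<exists>f\<in>F. f \<noteq> 0 \<and> term_dvd (LT lt f) t}"
  have "ideal J polyring"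
  proof (rule ideal_polyringI)
    show "f + g \<in> J" if "f \<in> J" "g \<in> J" for f g
      using that keys_add[of f g] unfolding J_def by blast
    show "h * f \<in> J" if "f \<in> J" for f h
    proof -
      have "\<exists>g\<in>F. g \<noteq> 0 \<and> term_dvd (LT lt g) t" if "t \<in> Poly_Mapping.keys (h * f)" for t
      proof -
        from that obtain u v where "t = u + v" "v \<in> Poly_Mapping.keys f"
          using keys_mult[of h f] by blast
        then show ?thesis using \<open>f \<in> J\<close> term_dvd_add unfolding J_def by blast
      qed
      then show ?thesis unfolding J_def by blast
    qed
  qed (simp add: J_def)
  moreover have "{mono_poly (LT lt f) | f. f \<in> F \<and> f \<noteq> 0} \<subseteq> J"
    by (auto simp: J_def mono_poly_def)
  ultimately have "LT_ideal lt F \<subseteq> J"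
    unfolding LT_ideal_def by (rule ring.genideal_minimal[OF class_ring.ring_axioms])
  then show ?thesis using assms unfolding J_def by blast
qed

lemma LT_in_LT_ideal: "f \<in> F \<Longrightarrow> f \<noteq> 0 \<Longrightarrow> mono_poly (LT lt f) \<in> LT_ideal lt F"
  unfolding LT_ideal_def
  by (rule subsetD[OF ring.genideal_self[OF class_ring.ring_axioms]]) auto

lemma ideal_LT_ideal: "ideal (LT_ideal lt F) (polyring :: ('n, 'k::field) mpoly ring)"
  unfolding LT_ideal_def by (rule ring.genideal_ideal[OF class_ring.ring_axioms]) simp

lemma LT_ideal_eqI:
  fixes I G :: "('n, 'k::field) mpoly set"
  assumes "G \<subseteq> I"
    and dvd: "\<And>f. f \<in> I \<Longrightarrow> f \<noteq> 0 \<Longrightarrow> \<exists>g\<in>G. g \<noteq> 0 \<and> term_dvd (LT lt g) (LT lt f)"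
  shows "LT_ideal lt G = LT_ideal lt I"
proof
  show "LT_ideal lt G \<subseteq> LT_ideal lt I"
    unfolding LT_ideal_def[of lt G]
    by (rule ring.genideal_minimal[OF class_ring.ring_axioms ideal_LT_ideal])
      (use assms(1) LT_in_LT_ideal in blast)
  show "LT_ideal lt I \<subseteq> LT_ideal lt G"
    unfolding LT_ideal_def[of lt I]
  proof (rule ring.genideal_minimal[OF class_ring.ring_axioms ideal_LT_ideal], safe)
    fix f assume "f \<in> I" "f \<noteq> 0"
    then obtain g where g: "g \<in> G" "g \<noteq> 0" "term_dvd (LT lt g) (LT lt f)" using dvd by blast
    then obtain u where "LT lt f = u + LT lt g" unfolding term_dvd_def by (metis add.commute)
    then have "mono_poly (LT lt f) = mono_poly u * mono_poly (LT lt g)" by simp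
    then show "mono_poly (LT lt f) \<in> LT_ideal lt G"
      using ideal_polyringD(4)[OF ideal_LT_ideal LT_in_LT_ideal[OF g(1,2)]] by metis
  qed
qed

section \<open>Linear combinations of terms modulo an ideal\<close>

text \<open>The coefficients are a function on indices, of which only the values below
  \<open>length ts\<close> count, so that vectors, matrix columns, lists and \<open>lookup\<close>
  can be plugged in alike.\<close>

definition term_comb :: "'n pp list \<Rightarrow> (nat \<Rightarrow> 'k) \<Rightarrow> ('n, 'k::field) mpoly" where
  "term_comb ts a = (\<Sum>i<length ts. Poly_Mapping.single (ts ! i) (a i))"

lemma term_comb_cong:
  "(\<And>i. i < length ts \<Longrightarrow> a i = b i) \<Longrightarrow> term_comb ts a = term_comb ts b"
  by (simp add: term_comb_def)

lemma keys_term_comb: "Poly_Mapping.keys (term_comb ts a) \<subseteq> set ts"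
proof -
  have "Poly_Mapping.keys (term_comb ts a) \<subseteq>
      (\<Union>i<length ts. Poly_Mapping.keys (Poly_Mapping.single (ts ! i) (a i)))"
    unfolding term_comb_def by (rule keys_sum)
  then show ?thesis by (force split: if_splits)
qed

lemma lookup_term_comb:
  assumes "distinct ts" "i < length ts"
  shows "Poly_Mapping.lookup (term_comb ts a) (ts ! i) = a i"
proof -
  have "Poly_Mapping.lookup (term_comb ts a) (ts ! i) = (\<Sum>j<length ts. if j = i then a j else 0)"
    unfolding term_comb_def lookup_sum
    by (rule sum.cong) (use assms in \<open>auto simp: lookup_single when_def nth_eq_iff_index_eq\<close>)
  then show ?thesis using assms(2) by simp
qed

lemma term_comb_lookup:
  assumes "distinct ts" "Poly_Mapping.keys f \<subseteq> set ts"
  shows "term_comb ts (\<lambda>i. Poly_Mapping.lookup f (ts ! i)) = f"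
proof (rule poly_mapping_eqI)
  fix t
  show "Poly_Mapping.lookup (term_comb ts (\<lambda>i. Poly_Mapping.lookup f (ts ! i))) t =
    Poly_Mapping.lookup f t"
  proof (cases "t \<in> set ts")
    case True
    then show ?thesis using lookup_term_comb[OF assms(1)] by (auto simp: in_set_conv_nth)
  next
    case False
    then show ?thesis
      using assms(2) keys_term_comb by (metis in_keys_iff subsetD)
  qed
qed

lemma const_mult_single:
  "Poly_Mapping.single 0 c * Poly_Mapping.single t d = Poly_Mapping.single t (c * d :: 'k::field)"
  by (simp add: mult_single)

lemma const_mult_term_comb:
  "Poly_Mapping.single 0 c * term_comb ts a = term_comb ts (\<lambda>i. c * a i)"
  by (simp add: term_comb_def sum_distrib_left const_mult_single)

lemma term_comb_add: "term_comb ts a + term_comb ts b = term_comb ts (\<lambda>i. a i + b i)"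
  by (simp add: term_comb_def sum.distrib single_add)

lemma term_comb_sum: "(\<Sum>j\<in>J. term_comb ts (a j)) = term_comb ts (\<lambda>i. \<Sum>j\<in>J. a j i)"
proof (induction J rule: infinite_finite_induct)
  case (insert x F)
  then show ?case by (simp add: term_comb_add)
qed (simp_all add: term_comb_def)

lemma mult_term_comb:
  "mono_poly s * term_comb ts a =
    (\<Sum>j<length ts. Poly_Mapping.single 0 (a j) * (mono_poly s * mono_poly (ts ! j)))"
  by (simp add: term_comb_def sum_distrib_left mono_poly_def mult_single)

section \<open>Congruence modulo a proper ideal\<close>

locale proper_poly_ideal =
  fixes I :: "('n::finite, 'k::field) mpoly set"
  assumes ideal: "ideal I polyring" and proper: "I \<subset> UNIV"
begin

lemmas zero_mem = ideal_polyringD(1)[OF ideal]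
  and add_mem = ideal_polyringD(2)[OF ideal]
  and minus_mem = ideal_polyringD(3)[OF ideal]
  and mult_mem = ideal_polyringD(4)[OF ideal]

lemma diff_mem: "f \<in> I \<Longrightarrow> g \<in> I \<Longrightarrow> f - g \<in> I"
  using add_mem[of f "- g"] minus_mem[of g] by simp

lemma sum_mem: "(\<And>x. x \<in> A \<Longrightarrow> f x \<in> I) \<Longrightarrow> sum f A \<in> I"
  by (induction A rule: infinite_finite_induct) (auto simp: zero_mem add_mem)

lemma const_notin:
  assumes "c \<noteq> 0"
  shows "Poly_Mapping.single 0 c \<notin> I"
proof
  assume "Poly_Mapping.single 0 c \<in> I"
  \<comment> \<open>A nonzero constant is a unit, so \<open>I\<close> would contain every polynomial
    \<open>f\<close>.\<close>
  then have "f * Poly_Mapping.single 0 (inverse c) * Poly_Mapping.single 0 c \<in> I" for f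
    by (rule mult_mem)
  then have "f \<in> I" for f
    using assms by (simp add: mult.assoc mult_single)
  then show False using proper by blast
qed

definition cong :: "('n, 'k) mpoly \<Rightarrow> ('n, 'k) mpoly \<Rightarrow> bool" (infix \<open>\<approx>\<^sub>I\<close> 50) where
  "f \<approx>\<^sub>I g \<longleftrightarrow> f - g \<in> I"

lemma cong_refl [simp]: "f \<approx>\<^sub>I f"
  by (simp add: cong_def zero_mem)

lemma cong_sym: "f \<approx>\<^sub>I g \<Longrightarrow> g \<approx>\<^sub>I f"
  unfolding cong_def using minus_mem[of "f - g"] by simp

lemma cong_trans [trans]: "f \<approx>\<^sub>I g \<Longrightarrow> g \<approx>\<^sub>I h \<Longrightarrow> f \<approx>\<^sub>I h"
  unfolding cong_def using add_mem[of "f - g" "g - h"] by simp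

lemma cong_add: "f \<approx>\<^sub>I g \<Longrightarrow> f' \<approx>\<^sub>I g' \<Longrightarrow> f + f' \<approx>\<^sub>I g + g'"
  unfolding cong_def using add_mem[of "f - g" "f' - g'"] by (simp add: algebra_simps)

lemma cong_diff: "f \<approx>\<^sub>I g \<Longrightarrow> f' \<approx>\<^sub>I g' \<Longrightarrow> f - f' \<approx>\<^sub>I g - g'"
  unfolding cong_def using diff_mem[of "f - g" "f' - g'"] by (simp add: algebra_simps)

lemma cong_mult: "f \<approx>\<^sub>I g \<Longrightarrow> h * f \<approx>\<^sub>I h * g"
  unfolding cong_def using mult_mem[of "f - g" h] by (simp add: algebra_simps)

lemma cong_sum: "(\<And>x. x \<in> A \<Longrightarrow> f x \<approx>\<^sub>I g x) \<Longrightarrow> sum f A \<approx>\<^sub>I sum g A"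
  unfolding cong_def using sum_mem[of A "\<lambda>x. f x - g x"] by (simp add: sum_subtractf)

lemma cong_zero_iff: "f \<approx>\<^sub>I 0 \<longleftrightarrow> f \<in> I"
  by (simp add: cong_def)

text \<open>The bridge between the hypotheses, which speak of the quotient ring, and the later
  arguments, which work with congruent representatives.\<close>

lemma coset_eq_iff: "I +>\<^bsub>polyring\<^esub> f = I +>\<^bsub>polyring\<^esub> g \<longleftrightarrow> f \<approx>\<^sub>I g"
proof -
  have "f \<ominus>\<^bsub>polyring\<^esub> g \<in> I \<longleftrightarrow> I +>\<^bsub>polyring\<^esub> f = I +>\<^bsub>polyring\<^esub> g"
    by (rule ring.quotient_eq_iff_same_a_r_cos[OF class_ring.ring_axioms ideal]) simp_all
  then show ?thesis by (simp add: cong_def class_ring_simps)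
qed

lemma coset_hom: "ring_hom_ring polyring (polyring Quot I) ((+>\<^bsub>polyring\<^esub>) I)"
  by (rule ideal.rcos_ring_hom_ring[OF ideal])

lemma mult_matrix_cong:
  assumes "mult_matrix I ws k N" "j < length ws"
  shows "mono_poly (var k) * mono_poly (ws ! j) \<approx>\<^sub>I term_comb ws (\<lambda>i. N $$ (i, j))"
proof -
  interpret h: ring_hom_ring polyring "polyring Quot I" "(+>\<^bsub>polyring\<^esub>) I"
    by (rule coset_hom)
  let ?t = "\<lambda>i. Poly_Mapping.single 0 (N $$ (i, j)) * mono_poly (ws ! i)"
  have "I +>\<^bsub>polyring\<^esub> (mono_poly (var k) * mono_poly (ws ! j)) =
    (\<Oplus>\<^bsub>polyring Quot I\<^esub> i \<in> {..<length ws}. I +>\<^bsub>polyring\<^esub> ?t i)"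
    using assms h.hom_mult by (simp add: mult_matrix_def quot_scalar_def)
  also have "\<dots> = I +>\<^bsub>polyring\<^esub> (\<Sum>i<length ws. ?t i)"
    using h.hom_finsum[of ?t "{..<length ws}"] by (simp add: class_ring_simps o_def)
  also have "(\<Sum>i<length ws. ?t i) = term_comb ws (\<lambda>i. N $$ (i, j))"
    by (simp add: term_comb_def mono_poly_def mult_single)
  finally show ?thesis by (simp add: coset_eq_iff)
qed

section \<open>The quotient as a vector space and its dimension\<close>

lemma combine_cosets:
  assumes "length cs = length ts"
  shows "ring.combine (polyring Quot I) (map (quot_scalar I) cs)
      (map (\<lambda>t. I +>\<^bsub>polyring\<^esub> mono_poly t) ts) = I +>\<^bsub>polyring\<^esub> term_comb ts ((!) cs)"
proof -
  interpret h: ring_hom_ring polyring "polyring Quot I" "(+>\<^bsub>polyring\<^esub>) I"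
    by (rule coset_hom)
  show ?thesis using assms
  proof (induction cs ts rule: list_induct2)
    case Nil
    show ?case using h.hom_zero by (simp add: term_comb_def)
  next
    case (Cons c cs t ts)
    have "term_comb (t # ts) ((!) (c # cs)) =
      Poly_Mapping.single 0 c * mono_poly t + term_comb ts ((!) cs)"
      by (simp add: term_comb_def sum.lessThan_Suc_shift mono_poly_def mult_single
          del: sum.lessThan_Suc)
    then show ?case
      using Cons.IH h.hom_add h.hom_mult by (simp add: quot_scalar_def)
  qed
qed

text \<open>The image of a field under a ring homomorphism is a subfield once 1 and 0 differ in the
  target; properness of \<open>I\<close> provides this.\<close>

lemma subfield_quot_scalar: "subfield (range (quot_scalar I)) (polyring Quot I)"
proof -
  interpret h: ring_hom_ring polyring "polyring Quot I" "(+>\<^bsub>polyring\<^esub>) I"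
    by (rule coset_hom)
  have "ring_hom_ring (class_ring :: 'k ring) (polyring Quot I) (quot_scalar I)"
  proof (rule ring_hom_ringI)
    show "ring (class_ring :: 'k ring)" by (rule class_ring.ring_axioms)
    show "ring (polyring Quot I)" by (rule h.S.ring_axioms)
    show "quot_scalar I x \<in> carrier (polyring Quot I)" for x
      using h.hom_closed by (simp add: quot_scalar_def)
    show "quot_scalar I (x \<otimes>\<^bsub>class_ring\<^esub> y) =
        quot_scalar I x \<otimes>\<^bsub>polyring Quot I\<^esub> quot_scalar I y" for x y
      using h.hom_mult[of "Poly_Mapping.single 0 x" "Poly_Mapping.single 0 y"]
      by (simp add: quot_scalar_def mult_single)
    show "quot_scalar I (x \<oplus>\<^bsub>class_ring\<^esub> y) =
        quot_scalar I x \<oplus>\<^bsub>polyring Quot I\<^esub> quot_scalar I y" for x y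
      using h.hom_add[of "Poly_Mapping.single 0 x" "Poly_Mapping.single 0 y"]
      by (simp add: quot_scalar_def single_add)
    show "quot_scalar I \<one>\<^bsub>class_ring\<^esub> = \<one>\<^bsub>polyring Quot I\<^esub>"
      using h.hom_one by (simp add: quot_scalar_def)
  qed
  then interpret q: ring_hom_ring "class_ring :: 'k ring" "polyring Quot I" "quot_scalar I" .
  have "\<one>\<^bsub>polyring Quot I\<^esub> \<noteq> \<zero>\<^bsub>polyring Quot I\<^esub>"
  proof
    assume "\<one>\<^bsub>polyring Quot I\<^esub> = \<zero>\<^bsub>polyring Quot I\<^esub>"
    then have "I +>\<^bsub>polyring\<^esub> 1 = I +>\<^bsub>polyring\<^esub> 0"
      using h.hom_one h.hom_zero by simp
    then have "1 \<in> I" by (simp add: coset_eq_iff cong_zero_iff)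
    then show False using const_notin[of 1] by simp
  qed
  moreover have "subfield UNIV (class_ring :: 'k ring)"
    using field.carrier_is_subfield[OF class_field[where 'a = 'k]] by simp
  ultimately show ?thesis using q.img_is_subfield(2) by blast
qed

lemma quot_dim_eq_length:
  assumes indep: "\<And>a. term_comb ws a \<in> I \<Longrightarrow> \<forall>i<length ws. a i = 0"
    and span: "\<And>f. \<exists>a. f \<approx>\<^sub>I term_comb ws a"
  shows "quot_dim I = length ws"
proof -
  interpret h: ring_hom_ring polyring "polyring Quot I" "(+>\<^bsub>polyring\<^esub>) I"
    by (rule coset_hom)
  let ?K = "range (quot_scalar I)"
  let ?Us = "map (\<lambda>t. I +>\<^bsub>polyring\<^esub> mono_poly t) ws"
  note sf = subfield_quot_scalar
  have zero: "\<zero>\<^bsub>polyring Quot I\<^esub> = I +>\<^bsub>polyring\<^esub> 0" using h.hom_zero by simp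
  have scal0: "quot_scalar I 0 = \<zero>\<^bsub>polyring Quot I\<^esub>" by (simp add: quot_scalar_def zero)
  have Us: "set ?Us \<subseteq> carrier (polyring Quot I)" using h.hom_closed by auto
  have scalars: "\<exists>cs. Ks = map (quot_scalar I) cs" if "set Ks \<subseteq> ?K" for Ks
    using that by (metis ex_map_conv rangeE subsetD)
  have carrier: "\<exists>f. x = I +>\<^bsub>polyring\<^esub> f" if "x \<in> carrier (polyring Quot I)" for x
    using that by (auto simp: FactRing_def A_RCOSETS_def')
  have "h.S.Span ?K ?Us = carrier (polyring Quot I)"
  proof
    show "h.S.Span ?K ?Us \<subseteq> carrier (polyring Quot I)"
      using h.S.Span_in_carrier[OF _ Us] subfieldE(3)[OF sf] by blast
    show "carrier (polyring Quot I) \<subseteq> h.S.Span ?K ?Us"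
    proof
      fix x assume "x \<in> carrier (polyring Quot I)"
      then obtain f where f: "x = I +>\<^bsub>polyring\<^esub> f" using carrier by blast
      obtain a where a: "f \<approx>\<^sub>I term_comb ws a" using span by blast
      let ?cs = "map a [0..<length ws]"
      have "term_comb ws ((!) ?cs) = term_comb ws a" by (rule term_comb_cong) simp
      then have "x = h.S.combine (map (quot_scalar I) ?cs) ?Us"
        using combine_cosets[of ?cs ws] a by (simp add: f coset_eq_iff)
      moreover have "set (map (quot_scalar I) ?cs) \<subseteq> ?K"
        "length (map (quot_scalar I) ?cs) = length ?Us" by auto
      ultimately show "x \<in> h.S.Span ?K ?Us"
        unfolding h.S.Span_mem_iff_length_version[OF sf Us] by blast
    qed
  qed
  moreover have "h.S.independent ?K ?Us"
  proof (rule h.S.trivial_combine_imp_independent[OF sf Us])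
    fix Ks assume "set Ks \<subseteq> ?K" and comb: "h.S.combine Ks ?Us = \<zero>\<^bsub>polyring Quot I\<^esub>"
    then obtain cs where cs: "Ks = map (quot_scalar I) cs" using scalars by blast
    \<comment> \<open>The criterion for independence ranges over scalar lists of any length, and
      \<open>combine\<close> silently stops at the end of the shorter list. Cutting and padding with
      zeros gives a list of length exactly \<open>length ws\<close> with the same
      combination.\<close>
    define ds where "ds = take (length ws) cs @ replicate (length ws - length cs) 0"
    have len: "length ds = length ws" by (simp add: ds_def)
    have "map (quot_scalar I) ds =
      take (length ?Us) Ks @ replicate (length ws - length cs) \<zero>\<^bsub>polyring Quot I\<^esub>"
      by (simp add: ds_def cs take_map scal0)
    then have "h.S.combine (map (quot_scalar I) ds) ?Us = \<zero>\<^bsub>polyring Quot I\<^esub>"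
      using h.S.combine_append_replicate[OF Us] h.S.combine_take comb by metis
    then have "term_comb ws ((!) ds) \<in> I"
      using combine_cosets[OF len] by (simp add: zero coset_eq_iff cong_zero_iff)
    then have "\<forall>i<length ws. ds ! i = 0" by (rule indep)
    then have "set ds \<subseteq> {0}" by (auto simp: in_set_conv_nth len)
    then have "set (take (length ws) cs) \<subseteq> {0}" by (simp add: ds_def)
    then show "set (take (length ?Us) Ks) \<subseteq> {\<zero>\<^bsub>polyring Quot I\<^esub>}"
      by (auto simp: cs take_map scal0[symmetric])
  qed
  ultimately have "h.S.dimension (length ?Us) ?K (carrier (polyring Quot I))"
    using h.S.dimensionI[OF sf] by blast
  then show ?thesis
    using h.S.dimI[OF sf] by (simp add: quot_dim_def over_def)
qed

end

section \<open>Sorting and cleaning the queue\<close>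

lemma sorted_wrt_subseq: "subseq xs ys \<Longrightarrow> sorted_wrt R ys \<Longrightarrow> sorted_wrt R xs"
proof (induction rule: list_emb.induct)
  case (list_emb_Cons2 x y xs ys)
  then have "set xs \<subseteq> set ys" by (metis set_nths_subset subseq_conv_nths)
  with list_emb_Cons2 show ?case by auto
qed auto

context term_ord
begin

lemma sorted_wrt_imp_distinct: "sorted_wrt lt ts \<Longrightarrow> List.distinct ts"
  by (induction ts) auto

lemma sorted_wrt_le_distinct_imp_lt:
  "sorted_wrt le ts \<Longrightarrow> List.distinct ts \<Longrightarrow> sorted_wrt lt ts"
  by (induction ts) auto

lemma ex_sorted_arrangement: "\<exists>L. sorted_arrangement lt S A L"
proof (induction A)
  case empty
  show ?case by (rule exI[of _ "[]"]) (simp add: sorted_arrangement_def)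
next
  case (add p A)
  then obtain L where L: "mset L = A" "sorted_wrt le (map (pair_term S) L)"
    unfolding sorted_arrangement_def by blast
  have "\<exists>L'. mset L' = add_mset p (mset L) \<and> sorted_wrt le (map (pair_term S) L')"
    using L(2)
  proof (induction L)
    case Nil
    show ?case by (rule exI[of _ "[p]"]) simp
  next
    case (Cons q L)
    show ?case
    proof (cases "le (pair_term S p) (pair_term S q)")
      case True
      then have "sorted_wrt le (map (pair_term S) (p # q # L))"
        using Cons.prems by (auto intro: lt_trans)
      then show ?thesis by (intro exI[of _ "p # q # L"]) simp
    next
      case False
      from Cons obtain L' where L': "mset L' = add_mset p (mset L)"
        "sorted_wrt le (map (pair_term S) L')" by auto
      have "set L' = insert p (set L)"
        using arg_cong[OF L'(1), of set_mset] by simp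
      then have "sorted_wrt le (map (pair_term S) (q # L'))"
        using L'(2) Cons.prems False lt_linear by auto
      then show ?thesis using L'(1) by (intro exI[of _ "q # L'"]) simp
    qed
  qed
  then show ?case using L(1) by (auto simp: sorted_arrangement_def)
qed

end

text \<open>The recursion drops a pair if its term recurs later or is a multiple of a leading term,
  so the last pair of each remaining term is kept. One admissible choice is enough for the loop to
  proceed.\<close>

lemma ex_cleaned: "\<exists>L'. cleaned lt S G L L'"
proof (induction L)
  case Nil
  show ?case by (rule exI[of _ "[]"]) (simp add: cleaned_def)
next
  case (Cons p L)
  then obtain L' where L': "cleaned lt S G L L'" by blast
  show ?case
  proof (cases "pair_term S p \<in> pair_term S ` set L \<or> (\<exists>g\<in>set G. term_dvd (LT lt g) (pair_term S p))")
    case True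
    then have "cleaned lt S G (p # L) L'" using L' unfolding cleaned_def by auto
    then show ?thesis by blast
  next
    case False
    then have "cleaned lt S G (p # L) (p # L')" using L' unfolding cleaned_def by auto
    then show ?thesis by blast
  qed
qed

section \<open>Staircases and multiplication matrices\<close>

context proper_poly_ideal
begin

lemma groebner_basis_LT_dvd:
  assumes "groebner_basis lt I G" "term_ord lt" "f \<in> I" "f \<noteq> 0"
  shows "\<exists>g\<in>G. g \<noteq> 0 \<and> term_dvd (LT lt g) (LT lt f)"
proof (rule LT_ideal_keys)
  show "mono_poly (LT lt f) \<in> LT_ideal lt G"
    using LT_in_LT_ideal[OF assms(3,4), of lt] assms(1) by (simp add: groebner_basis_def)
qed (simp add: mono_poly_def)

text \<open>Otherwise the leading term of \<open>f\<close> would be both in the staircase and a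
  multiple of a leading term of \<open>G\<close>.\<close>

lemma staircase_independent:
  assumes "groebner_basis lt I G" "term_ord lt" "f \<in> I" "Poly_Mapping.keys f \<subseteq> staircase lt G"
  shows "f = 0"
proof (rule ccontr)
  assume "f \<noteq> 0"
  then obtain g where "g \<in> G" "term_dvd (LT lt g) (LT lt f)"
    using groebner_basis_LT_dvd[OF assms(1-3)] by blast
  moreover have "LT lt f \<in> staircase lt G"
    using term_ord.LT_greatest(1)[OF assms(2) \<open>f \<noteq> 0\<close>] assms(4) by blast
  ultimately show False by (simp add: staircase_def)
qed

text \<open>A leading term dividing 1 is 1 itself; as 1 is the least term, the basis element would
  be a nonzero constant, which a proper ideal excludes.\<close>

lemma zero_in_staircase:
  assumes "groebner_basis lt I G" "term_ord lt" "0 \<notin> G"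
  shows "0 \<in> staircase lt G"
proof -
  interpret term_ord lt by fact
  have False if g: "g \<in> G" and dvd: "term_dvd (LT lt g) 0" for g
  proof -
    have LT0: "LT lt g = 0" using dvd_imp_le[OF dvd] zero_le by (rule le_antisym)
    have g0: "g \<noteq> 0" using g assms(3) by blast
    have "s = 0" if "s \<in> Poly_Mapping.keys g" for s
      using LT_greatest(2)[OF g0 that] zero_le unfolding LT0 by (rule le_antisym)
    then have "g = Poly_Mapping.single 0 (Poly_Mapping.lookup g 0)"
      by (intro poly_mapping_eqI) (metis in_keys_iff lookup_single_eq lookup_single_not_eq)
    moreover have "Poly_Mapping.lookup g 0 \<noteq> 0"
      using LT_greatest(1)[OF g0] by (simp add: LT0 in_keys_iff)
    moreover have "g \<in> I" using g assms(1) by (auto simp: groebner_basis_def)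
    ultimately show False using const_notin[of "Poly_Mapping.lookup g 0"] by simp
  qed
  then show ?thesis by (auto simp: staircase_def)
qed

end

text \<open>This is what the algorithm takes from the first order and its basis. That
  \<open>ws\<close> starts with 1 makes the first unit vector the coordinates of 1, as the initial
  list V requires; that the classes of \<open>ws\<close> also span is derived below.\<close>

locale monomial_quotient_basis = proper_poly_ideal I
  for I :: "('n::finite, 'k::field) mpoly set" +
  fixes ws :: "'n pp list" and M :: "'n \<Rightarrow> 'k mat"
  assumes independent: "term_comb ws a \<in> I \<Longrightarrow> i < length ws \<Longrightarrow> a i = 0"
    and ws_0: "ws \<noteq> []" "ws ! 0 = 0"
    and mult_matrix: "mult_matrix I ws k (M k)"
begin

abbreviation D where "D \<equiv> length ws"

abbreviation vec_comb :: "'k vec \<Rightarrow> ('n, 'k) mpoly" where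
  "vec_comb v \<equiv> term_comb ws (($) v)"

lemma M_carrier: "M k \<in> carrier_mat D D"
  using mult_matrix unfolding mult_matrix_def by blast

lemma vec_comb_in_I:
  assumes "v \<in> carrier_vec D" "vec_comb v \<in> I"
  shows "v = 0\<^sub>v D"
  using assms independent[of "($) v"] by (intro eq_vecI) auto

text \<open>Column \<open>j\<close> of \<open>M k\<close> holds the coordinates of
  \<open>x_k w_j\<close>, and linearity extends this to every coordinate vector. Hence the vectors
  in V are coordinates of the terms in S.\<close>

lemma cong_M:
  assumes "mono_poly t \<approx>\<^sub>I vec_comb v" "v \<in> carrier_vec D"
  shows "mono_poly (var k + t) \<approx>\<^sub>I vec_comb (M k *\<^sub>v v)"
proof -
  have "mono_poly (var k + t) \<approx>\<^sub>I mono_poly (var k) * vec_comb v"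
    using cong_mult[OF assms(1), of "mono_poly (var k)"] by simp
  also have "mono_poly (var k) * vec_comb v =
      (\<Sum>j<D. Poly_Mapping.single 0 (v $ j) * (mono_poly (var k) * mono_poly (ws ! j)))"
    by (rule mult_term_comb)
  also have "\<dots> \<approx>\<^sub>I (\<Sum>j<D. Poly_Mapping.single 0 (v $ j) * term_comb ws (\<lambda>i. M k $$ (i, j)))"
    by (intro cong_sum cong_mult mult_matrix_cong mult_matrix) simp
  also have "\<dots> = term_comb ws (\<lambda>i. \<Sum>j<D. v $ j * M k $$ (i, j))"
    by (simp only: const_mult_term_comb term_comb_sum)
  also have "\<dots> = vec_comb (M k *\<^sub>v v)"
    by (rule term_comb_cong)
      (use M_carrier[of k] assms(2) in
        \<open>auto simp: scalar_prod_def mult.commute atLeast0LessThan intro!: sum.cong\<close>)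
  finally show ?thesis .
qed

lemma mono_poly_0: "mono_poly 0 = vec_comb (unit_vec D 0)"
  using ws_0 by (simp add: term_comb_def mono_poly_def if_distrib cong: if_cong)

text \<open>The span of the staircase contains 1 and is closed under multiplication by variables, so no
  division algorithm is needed.\<close>

lemma spanning: "\<exists>a. f \<approx>\<^sub>I term_comb ws a"
proof -
  have mono: "\<exists>v\<in>carrier_vec D. mono_poly t \<approx>\<^sub>I vec_comb v" for t
  proof (induction t rule: pp_induct)
    case zero
    show ?case by (metis mono_poly_0 cong_refl unit_vec_carrier)
  next
    case (var i t)
    then show ?case using cong_M M_carrier mult_mat_vec_carrier by blast
  qed
  then obtain v where v: "\<And>t. mono_poly t \<approx>\<^sub>I vec_comb (v t)" by metis
  have "f = (\<Sum>t\<in>Poly_Mapping.keys f. Poly_Mapping.single 0 (Poly_Mapping.lookup f t) * mono_poly t)"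
    unfolding single_eq_const_mult_mono[symmetric] by (rule poly_mapping_sum_single)
  also have "\<dots> \<approx>\<^sub>I (\<Sum>t\<in>Poly_Mapping.keys f.
      Poly_Mapping.single 0 (Poly_Mapping.lookup f t) * vec_comb (v t))"
    by (intro cong_sum cong_mult v)
  also have "\<dots> = term_comb ws (\<lambda>i. \<Sum>t\<in>Poly_Mapping.keys f. Poly_Mapping.lookup f t * v t $ i)"
    by (simp only: const_mult_term_comb term_comb_sum)
  finally show ?thesis by blast
qed

lemma quot_dim: "quot_dim I = D"
  using independent spanning by (intro quot_dim_eq_length) auto

definition vcomb :: "'k vec list \<Rightarrow> (nat \<Rightarrow> 'k) \<Rightarrow> 'k vec" where
  "vcomb V a = vec D (\<lambda>j. \<Sum>i<length V. a i * V ! i $ j)"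

lemma vcomb_carrier [simp]: "vcomb V a \<in> carrier_vec D"
  by (simp add: vcomb_def)

lemma term_comb_cong_vcomb:
  assumes "length V = length S" "\<And>i. i < length S \<Longrightarrow> mono_poly (S ! i) \<approx>\<^sub>I vec_comb (V ! i)"
  shows "term_comb S a \<approx>\<^sub>I vec_comb (vcomb V a)"
proof -
  have "term_comb S a = (\<Sum>i<length S. Poly_Mapping.single 0 (a i) * mono_poly (S ! i))"
    by (simp add: term_comb_def single_eq_const_mult_mono[symmetric])
  also have "\<dots> \<approx>\<^sub>I (\<Sum>i<length S. Poly_Mapping.single 0 (a i) * vec_comb (V ! i))"
    by (intro cong_sum cong_mult assms(2)) simp
  also have "\<dots> = term_comb ws (\<lambda>j. \<Sum>i<length S. a i * V ! i $ j)"
    by (simp only: const_mult_term_comb term_comb_sum)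
  also have "\<dots> = vec_comb (vcomb V a)"
    by (rule term_comb_cong) (simp add: vcomb_def assms(1))
  finally show ?thesis .
qed

text \<open>As \<open>P\<close> sends the listed vectors to unit vectors, it reads the coefficients
  off a linear combination. Both the independence of S and the relations put into G rest on
  this.\<close>

lemma mult_mat_vcomb:
  assumes P: "P \<in> carrier_mat D D" and len: "length V \<le> D"
    and V: "\<And>i. i < length V \<Longrightarrow> V ! i \<in> carrier_vec D \<and> P *\<^sub>v V ! i = unit_vec D i"
  shows "P *\<^sub>v vcomb V a = vec D (\<lambda>j. if j < length V then a j else 0)"
proof (rule eq_vecI)
  fix j assume "j < dim_vec (vec D (\<lambda>j. if j < length V then a j else 0))"
  then have j: "j < D" by simp
  have "(P *\<^sub>v vcomb V a) $ j = (\<Sum>m<D. P $$ (j, m) * (\<Sum>i<length V. a i * V ! i $ m))"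
    using P j by (simp add: vcomb_def scalar_prod_def atLeast0LessThan)
  also have "\<dots> = (\<Sum>m<D. \<Sum>i<length V. a i * (P $$ (j, m) * V ! i $ m))"
    by (simp add: sum_distrib_left mult.left_commute)
  also have "\<dots> = (\<Sum>i<length V. a i * (\<Sum>m<D. P $$ (j, m) * V ! i $ m))"
    unfolding sum_distrib_left by (rule sum.swap)
  also have "\<dots> = (\<Sum>i<length V. a i * (P *\<^sub>v V ! i) $ j)"
  proof (intro sum.cong refl arg_cong[of _ _ "(*) (a _)"])
    fix i assume "i \<in> {..<length V}"
    then have "dim_vec (V ! i) = D" using V by auto
    then show "(\<Sum>m<D. P $$ (j, m) * V ! i $ m) = (P *\<^sub>v V ! i) $ j"
      using P j by (simp add: scalar_prod_def atLeast0LessThan)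
  qed
  also have "\<dots> = (\<Sum>i<length V. if i = j then a i else 0)"
    using V j by (intro sum.cong) (auto simp: unit_vec_def)
  also have "\<dots> = (if j < length V then a j else 0)" by simp
  finally show "(P *\<^sub>v vcomb V a) $ j = vec D (\<lambda>j. if j < length V then a j else 0) $ j"
    using j by simp
qed (use P in auto)

end

section \<open>The elimination step\<close>

text \<open>Row operations on \<open>P\<close> act on the entries of \<open>w = P u\<close> in the
  same way: \<open>c\<close> is the new pivot entry, and position \<open>k\<close> is treated with
  the old entry \<open>r\<close> that the swap moved there. If \<open>k = r\<close>, the first
  branch decides.\<close>

lemma index_fglm_update_mult:
  fixes P :: "'k::field mat"
  assumes P: "P \<in> carrier_mat n n" and lam: "lam \<in> carrier_vec n" and u: "u \<in> carrier_vec n"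
    and k: "k = (LEAST i. r \<le> i \<and> i < n \<and> lam $ i \<noteq> 0)"
    and r: "r < n" and kn: "k < n" and i: "i < n"
  shows "(fglm_update P r lam *\<^sub>v u) $ i =
    (let w = P *\<^sub>v u; c = w $ k / lam $ k in
      if i = r then c else (if i = k then w $ r - lam $ r * c else w $ i - lam $ i * c))"
proof -
  have dim: "dim_vec lam = n" "dim_row P = n" "dim_col P = n" "dim_vec u = n"
    using P lam u by auto
  have w: "(P *\<^sub>v u) $ m = (\<Sum>j<n. P $$ (m, j) * u $ j)" if "m < n" for m
    using that dim by (simp add: scalar_prod_def atLeast0LessThan)
  have ent: "fglm_update P r lam $$ (i, j) =
      (if i = r then inverse (lam $ k) * P $$ (k, j)
       else (if i = k then P $$ (r, j) - lam $ r * (inverse (lam $ k) * P $$ (k, j))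
       else P $$ (i, j) - lam $ i * (inverse (lam $ k) * P $$ (k, j))))" if "j < n" for j
    using that r kn i dim by (auto simp: fglm_update_def Let_def k[symmetric])
  have "fglm_update P r lam \<in> carrier_mat n n"
    using dim by (simp add: fglm_update_def Let_def)
  then have "(fglm_update P r lam *\<^sub>v u) $ i = (\<Sum>j<n. fglm_update P r lam $$ (i, j) * u $ j)"
    using i dim by (simp add: scalar_prod_def atLeast0LessThan)
  also have "\<dots> = (\<Sum>j<n. (if i = r then inverse (lam $ k) * (P $$ (k, j) * u $ j)
       else (if i = k then P $$ (r, j) * u $ j - lam $ r * (inverse (lam $ k) * (P $$ (k, j) * u $ j))
       else P $$ (i, j) * u $ j - lam $ i * (inverse (lam $ k) * (P $$ (k, j) * u $ j)))))"
    by (rule sum.cong) (simp_all add: ent algebra_simps)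
  also have "\<dots> = (if i = r then inverse (lam $ k) * (P *\<^sub>v u) $ k
       else (if i = k then (P *\<^sub>v u) $ r - lam $ r * (inverse (lam $ k) * (P *\<^sub>v u) $ k)
       else (P *\<^sub>v u) $ i - lam $ i * (inverse (lam $ k) * (P *\<^sub>v u) $ k)))"
    by (simp add: w r kn i sum_subtractf sum_distrib_left)
  finally show ?thesis by (simp add: Let_def divide_inverse mult.commute)
qed

text \<open>Earlier unit vectors survive because their entries at \<open>r\<close> and at the pivot
  position \<open>k >= r\<close> vanish, while \<open>lam\<close> itself is eliminated down to a
  unit vector. The last claim lets a trivial kernel pass from \<open>P\<close> to the updated
  matrix.\<close>

lemma fglm_update_correct:
  fixes P :: "'k::field mat"
  assumes P: "P \<in> carrier_mat n n" and lam: "lam \<in> carrier_vec n"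
    and ex: "\<exists>i. r \<le> i \<and> i < n \<and> lam $ i \<noteq> 0"
  shows "fglm_update P r lam \<in> carrier_mat n n"
    and "\<And>u i. u \<in> carrier_vec n \<Longrightarrow> i < r \<Longrightarrow> P *\<^sub>v u = unit_vec n i \<Longrightarrow>
      fglm_update P r lam *\<^sub>v u = unit_vec n i"
    and "\<And>u. u \<in> carrier_vec n \<Longrightarrow> P *\<^sub>v u = lam \<Longrightarrow> fglm_update P r lam *\<^sub>v u = unit_vec n r"
    and "\<And>u. u \<in> carrier_vec n \<Longrightarrow> fglm_update P r lam *\<^sub>v u = 0\<^sub>v n \<Longrightarrow> P *\<^sub>v u = 0\<^sub>v n"
proof -
  define k where "k = (LEAST i. r \<le> i \<and> i < n \<and> lam $ i \<noteq> 0)"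
  have k: "r \<le> k" "k < n" "lam $ k \<noteq> 0"
    using LeastI_ex[OF ex] unfolding k_def by auto
  then have r: "r < n" by simp
  note idx = index_fglm_update_mult[OF P lam _ k_def r k(2), unfolded Let_def]
  show carrier: "fglm_update P r lam \<in> carrier_mat n n"
    using P lam by (simp add: fglm_update_def Let_def)
  have dims: "dim_row (fglm_update P r lam) = n"
    using carrier by simp
  show "fglm_update P r lam *\<^sub>v u = unit_vec n i"
    if u: "u \<in> carrier_vec n" and i: "i < r" and eq: "P *\<^sub>v u = unit_vec n i" for u i
  proof (rule eq_vecI)
    fix j assume "j < dim_vec (unit_vec n i :: 'k vec)"
    then have j: "j < n" by simp
    show "(fglm_update P r lam *\<^sub>v u) $ j = unit_vec n i $ j"
      unfolding idx[OF u j] eq using k i j r by (auto simp: unit_vec_def)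
  qed (simp add: dims)
  show "fglm_update P r lam *\<^sub>v u = unit_vec n r"
    if u: "u \<in> carrier_vec n" and eq: "P *\<^sub>v u = lam" for u
  proof (rule eq_vecI)
    fix j assume "j < dim_vec (unit_vec n r :: 'k vec)"
    then have j: "j < n" by simp
    show "(fglm_update P r lam *\<^sub>v u) $ j = unit_vec n r $ j"
      unfolding idx[OF u j] eq using k j r by (auto simp: unit_vec_def)
  qed (simp add: dims)
  show "P *\<^sub>v u = 0\<^sub>v n" if u: "u \<in> carrier_vec n" and eq: "fglm_update P r lam *\<^sub>v u = 0\<^sub>v n" for u
  proof (rule eq_vecI)
    fix i assume "i < dim_vec (0\<^sub>v n :: 'k vec)"
    then have i: "i < n" by simp
    define w where "w = P *\<^sub>v u"
    \<comment> \<open>Entry \<open>r\<close> of the updated product is \<open>w_k\<close> divided by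
      the nonzero pivot. So \<open>w_k = 0\<close> and all corrections vanish; the remaining entries
      are then visible directly, \<open>w_r\<close> at position \<open>k\<close> because of the
      swap.\<close>
    have wk: "w $ k = 0" using idx[OF u r, folded w_def] r k by (simp add: eq)
    have "w $ i = 0" if "i \<noteq> k"
    proof (cases "i = r")
      case True
      then show ?thesis using idx[OF u k(2), folded w_def] k that by (simp add: eq wk)
    next
      case False
      then show ?thesis using idx[OF u i, folded w_def] i that by (simp add: eq wk)
    qed
    then show "(P *\<^sub>v u) $ i = 0\<^sub>v n $ i"
      using wk i unfolding w_def[symmetric] by (cases "i = k") simp_all
  qed (use P in simp)
qed

section \<open>Invariants of the algorithm\<close>

locale fglm = monomial_quotient_basis I ws M + term_ord lt
  for I :: "('n::finite, 'k::field) mpoly set" and ws :: "'n pp list" and M :: "'n \<Rightarrow> 'k mat"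
    and lt :: "'n pp \<Rightarrow> 'n pp \<Rightarrow> bool"
begin

definition LT_multiple :: "('n, 'k) mpoly list \<Rightarrow> 'n pp \<Rightarrow> bool" where
  "LT_multiple G t \<longleftrightarrow> (\<exists>g\<in>set G. term_dvd (LT lt g) t)"

lemma LT_multiple_add: "LT_multiple G t \<Longrightarrow> LT_multiple G (u + t)"
  unfolding LT_multiple_def using term_dvd_add by blast

lemma LT_multiple_append: "LT_multiple (G @ [g]) t \<longleftrightarrow> LT_multiple G t \<or> term_dvd (LT lt g) t"
  by (auto simp: LT_multiple_def)

text \<open>Invertibility of the square matrix \<open>P\<close> is recorded as a trivial kernel, the
  form in which \<open>relation_in_I\<close> applies it and \<open>fglm_update_correct\<close>
  preserves it.\<close>

definition lin_inv :: "'n pp list \<Rightarrow> 'k vec list \<Rightarrow> 'k mat \<Rightarrow> bool" where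
  "lin_inv S V P \<longleftrightarrow> length V = length S \<and> length S \<le> D \<and> P \<in> carrier_mat D D \<and>
     (\<forall>u\<in>carrier_vec D. P *\<^sub>v u = 0\<^sub>v D \<longrightarrow> u = 0\<^sub>v D) \<and>
     (\<forall>i<length S. V ! i \<in> carrier_vec D \<and> mono_poly (S ! i) \<approx>\<^sub>I vec_comb (V ! i) \<and>
        P *\<^sub>v V ! i = unit_vec D i)"

text \<open>The condition on the terms of \<open>g\<close> means that \<open>g\<close> expresses its
  leading term modulo \<open>I\<close> as a combination of entries of \<open>S\<close>.\<close>

definition stair_inv :: "'n pp list \<Rightarrow> ('n, 'k) mpoly list \<Rightarrow> bool" where
  "stair_inv S G \<longleftrightarrow> sorted_wrt lt S \<and> 0 \<in> set S \<and> (\<forall>s\<in>set S. \<not> LT_multiple G s) \<and>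
     (\<forall>g\<in>set G. g \<in> I \<and> Poly_Mapping.lookup g (LT lt g) = 1 \<and>
        Poly_Mapping.keys g \<subseteq> insert (LT lt g) (set S))"

text \<open>The last clause is completeness of the queue, which for an empty queue closes
  \<open>S\<close> up to multiples of leading terms. The bound by \<open>S\<close> makes the next
  term either the leading term of a relation or the new maximum of \<open>S\<close>.\<close>

definition queue_inv :: "'n pp list \<Rightarrow> ('n, 'k) mpoly list \<Rightarrow> ('n \<times> nat) list \<Rightarrow> bool" where
  "queue_inv S G L \<longleftrightarrow> sorted_wrt lt (map (pair_term S) L) \<and>
     (\<forall>p\<in>set L. snd p < length S \<and> \<not> LT_multiple G (pair_term S p) \<and>
        (\<forall>s\<in>set S. lt s (pair_term S p))) \<and>
     (\<forall>s\<in>set S. \<forall>i. var i + s \<in> set S \<union> pair_term S ` set L \<or> LT_multiple G (var i + s))"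

definition fglm_inv :: "('n, 'k) fglm_state \<Rightarrow> bool" where
  "fglm_inv st \<longleftrightarrow> (case st of (S, V, G, P, L) \<Rightarrow>
     lin_inv S V P \<and> stair_inv S G \<and> queue_inv S G L)"

text \<open>A combination in \<open>I\<close> has coordinate vector 0 because \<open>ws\<close> is
  independent; applying \<open>P\<close> to that vector returns the coefficients.\<close>

lemma term_comb_in_I_imp_0:
  assumes "lin_inv S V P" "term_comb S a \<in> I" "i < length S"
  shows "a i = 0"
proof -
  have "term_comb S a \<approx>\<^sub>I vec_comb (vcomb V a)"
    using assms(1) by (intro term_comb_cong_vcomb) (auto simp: lin_inv_def)
  then have "vec_comb (vcomb V a) \<in> I"
    using assms(2) cong_sym cong_trans cong_zero_iff by blast
  then have "vcomb V a = 0\<^sub>v D" by (intro vec_comb_in_I) simp_all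
  moreover have "P *\<^sub>v vcomb V a = vec D (\<lambda>j. if j < length V then a j else 0)"
    using assms(1) by (intro mult_mat_vcomb) (auto simp: lin_inv_def)
  moreover have "P *\<^sub>v 0\<^sub>v D = 0\<^sub>v D"
    using assms(1) by (intro eq_vecI) (auto simp: lin_inv_def)
  ultimately have "vec D (\<lambda>j. if j < length V then a j else 0) $ i = 0\<^sub>v D $ i" by metis
  then show ?thesis using assms(1,3) by (simp add: lin_inv_def)
qed

text \<open>Since the tail of \<open>P v\<close> vanishes, the combination of \<open>V\<close> with
  coefficients \<open>P v\<close> has the same image under \<open>P\<close> as \<open>v\<close>, and
  the trivial kernel makes the two vectors equal.\<close>

lemma relation_in_I:
  assumes inv: "lin_inv S V P" and v: "v \<in> carrier_vec D" "mono_poly t \<approx>\<^sub>I vec_comb v"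
    and zero: "\<And>i. length S \<le> i \<Longrightarrow> i < D \<Longrightarrow> (P *\<^sub>v v) $ i = 0"
  shows "mono_poly t - term_comb S (($) (P *\<^sub>v v)) \<in> I"
proof -
  let ?u = "vcomb V (($) (P *\<^sub>v v))"
  have P: "P \<in> carrier_mat D D" using inv by (simp add: lin_inv_def)
  have "P *\<^sub>v ?u = vec D (\<lambda>j. if j < length V then (P *\<^sub>v v) $ j else 0)"
    using inv by (intro mult_mat_vcomb) (auto simp: lin_inv_def)
  also have "\<dots> = P *\<^sub>v v"
  proof (rule eq_vecI)
    fix j assume "j < dim_vec (P *\<^sub>v v)"
    then have "j < D" using P by simp
    then show "vec D (\<lambda>j. if j < length V then (P *\<^sub>v v) $ j else 0) $ j = (P *\<^sub>v v) $ j"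
      using zero[of j] inv by (auto simp: lin_inv_def not_less)
  qed (use P in simp)
  finally have "P *\<^sub>v (v - ?u) = 0\<^sub>v D"
    using P v(1) mult_mat_vec_carrier[OF P v(1)] by (simp add: mult_minus_distrib_mat_vec[OF P])
  then have "v - ?u = 0\<^sub>v D"
    using inv v(1) by (auto simp: lin_inv_def)
  then have "v = ?u" using v(1)
    by (intro eq_vecI) (auto simp: vec_eq_iff vcomb_def)
  have "mono_poly t - term_comb S (($) (P *\<^sub>v v)) \<approx>\<^sub>I vec_comb v - vec_comb ?u"
    using inv by (intro cong_diff v term_comb_cong_vcomb) (auto simp: lin_inv_def)
  then show ?thesis by (simp add: \<open>v = ?u\<close>[symmetric] cong_zero_iff)
qed

lemma lin_inv_append:
  assumes inv: "lin_inv S V P" and v: "v \<in> carrier_vec D" "mono_poly t \<approx>\<^sub>I vec_comb v"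
    and ex: "\<exists>i. length S \<le> i \<and> i < D \<and> (P *\<^sub>v v) $ i \<noteq> 0"
  shows "lin_inv (S @ [t]) (V @ [v]) (fglm_update P (length S) (P *\<^sub>v v))"
proof -
  have P: "P \<in> carrier_mat D D" using inv by (simp add: lin_inv_def)
  note upd = fglm_update_correct[OF P mult_mat_vec_carrier[OF P v(1)] ex]
  show ?thesis
    unfolding lin_inv_def
  proof (intro conjI allI impI ballI)
    show "fglm_update P (length S) (P *\<^sub>v v) \<in> carrier_mat D D" by (rule upd)
    fix u assume "u \<in> carrier_vec D" "fglm_update P (length S) (P *\<^sub>v v) *\<^sub>v u = 0\<^sub>v D"
    then show "u = 0\<^sub>v D" using upd(4) inv by (auto simp: lin_inv_def)
  next
    fix i assume "i < length (S @ [t])"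
    then consider "i < length S" | "i = length S" by fastforce
    note cases = this
    show "(V @ [v]) ! i \<in> carrier_vec D"
      using cases inv v by cases (auto simp: lin_inv_def nth_append)
    show "mono_poly ((S @ [t]) ! i) \<approx>\<^sub>I vec_comb ((V @ [v]) ! i)"
      using cases inv v by cases (auto simp: lin_inv_def nth_append)
    show "fglm_update P (length S) (P *\<^sub>v v) *\<^sub>v (V @ [v]) ! i = unit_vec D i"
      using cases
    proof cases
      case 1
      then show ?thesis using inv upd(2)[of "V ! i" i] by (simp add: lin_inv_def nth_append)
    next
      case 2
      then show ?thesis using inv upd(3)[OF v(1)] by (simp add: lin_inv_def nth_append)
    qed
  \<comment> \<open>The extended list still has at most \<open>D\<close> entries, because a nonzero
    entry at some position \<open>i\<close> with \<open>length S <= i < D\<close> leaves room for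
    one more.\<close>
  qed (use inv ex in \<open>auto simp: lin_inv_def\<close>)
qed

lemma cleaned_queue:
  assumes "cleaned lt S G L L'" "sorted_wrt le (map (pair_term S) L)"
  shows "sorted_wrt lt (map (pair_term S) L')" "set L' \<subseteq> set L"
    "pair_term S ` set L' = {t \<in> pair_term S ` set L. \<not> LT_multiple G t}"
proof -
  have sub: "subseq L' L" and dist: "List.distinct (map (pair_term S) L')"
    and im: "pair_term S ` set L' = {t \<in> pair_term S ` set L. \<not> LT_multiple G t}"
    using assms(1) by (auto simp: cleaned_def LT_multiple_def)
  show "sorted_wrt lt (map (pair_term S) L')"
    using sorted_wrt_subseq[OF subseq_map[OF sub] assms(2)] dist
    by (rule sorted_wrt_le_distinct_imp_lt)
  show "set L' \<subseteq> set L" using sub by (metis set_nths_subset subseq_conv_nths)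
  show "pair_term S ` set L' = {t \<in> pair_term S ` set L. \<not> LT_multiple G t}" by (rule im)
qed

lemma sorted_wrt_lt_imp_le: "sorted_wrt lt ts \<Longrightarrow> sorted_wrt le ts"
  by (rule sorted_wrt_mono_rel) auto

lemma inv_cong_product:
  assumes "lin_inv S V P" "l < length S"
  shows "M k *\<^sub>v (V ! l) \<in> carrier_vec D"
    "mono_poly (pair_term S (k, l)) \<approx>\<^sub>I vec_comb (M k *\<^sub>v (V ! l))"
  using assms cong_M[of "S ! l" "V ! l" k] mult_mat_vec_carrier[OF M_carrier, of "V ! l" k]
  by (auto simp: lin_inv_def pair_term_def)

section \<open>Preservation of the invariants\<close>

lemma relation_step_inv:
  assumes inv: "fglm_inv (S, V, G, P, (k, l) # L)"
    and lam: "lam = P *\<^sub>v (M k *\<^sub>v (V ! l))" and zero: "\<forall>i. length S \<le> i \<and> i < D \<longrightarrow> lam $ i = 0"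
    and G': "G' = G @ [mono_poly (pair_term S (k, l)) -
      (\<Sum>i<length S. Poly_Mapping.single (S ! i) (lam $ i))]"
    and clean: "cleaned lt S G' L L'"
  shows "fglm_inv (S, V, G', P, L')"
proof -
  define t where "t = pair_term S (k, l)"
  define g where "g = mono_poly t - term_comb S (($) lam)"
  have G'_eq: "G' = G @ [g]" by (simp add: G' g_def t_def term_comb_def)
  have lin: "lin_inv S V P" and stair: "stair_inv S G" and queue: "queue_inv S G ((k, l) # L)"
    using inv by (simp_all add: fglm_inv_def)
  have l: "l < length S" and St: "\<And>s. s \<in> set S \<Longrightarrow> lt s t"
    using queue by (auto simp: queue_inv_def t_def)
  have gI: "g \<in> I"
    unfolding g_def lam t_def
    by (rule relation_in_I[OF lin inv_cong_product[OF lin l]]) (use zero lam in auto)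
  have tS: "t \<notin> set S" using St lt_irrefl by blast
  then have "Poly_Mapping.lookup (term_comb S (($) lam)) t = 0"
    using keys_term_comb by (metis in_keys_iff subsetD)
  then have gt: "Poly_Mapping.lookup g t = 1"
    by (simp add: g_def lookup_minus lookup_mono_poly)
  have keys_g: "Poly_Mapping.keys g \<subseteq> insert t (set S)"
    using keys_diff[of "mono_poly t" "term_comb S (($) lam)"] keys_term_comb[of S "($) lam"]
    by (auto simp: g_def mono_poly_def)
  have LT_g: "LT lt g = t"
    by (rule LT_eqI) (use gt keys_g St in \<open>auto simp: in_keys_iff\<close>)
  \<comment> \<open>A multiple of \<open>t\<close> is at least \<open>t\<close>, hence larger than
    every entry of \<open>S\<close>.\<close>
  have "\<not> term_dvd t s" if "s \<in> set S" for s
    using dvd_imp_le[of t s] St[OF that] lt_asym lt_irrefl by blast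
  then have stair': "stair_inv S G'"
    using stair gI gt keys_g unfolding G'_eq stair_inv_def LT_multiple_append
    by (auto simp: LT_g)
  have "sorted_wrt le (map (pair_term S) L)"
    using queue by (intro sorted_wrt_lt_imp_le) (simp add: queue_inv_def)
  note L' = cleaned_queue[OF clean this]
  have "queue_inv S G' L'"
    unfolding queue_inv_def
  proof (intro conjI ballI allI)
    show "sorted_wrt lt (map (pair_term S) L')" by (rule L')
    fix p assume p: "p \<in> set L'"
    then have "p \<in> set ((k, l) # L)" using L'(2) by auto
    then show "snd p < length S" "\<And>s. s \<in> set S \<Longrightarrow> lt s (pair_term S p)"
      using queue unfolding queue_inv_def by blast+
    show "\<not> LT_multiple G' (pair_term S p)" using L'(3) p by blast
  next
    fix s i assume s: "s \<in> set S"
    have "var i + s \<in> set S \<union> pair_term S ` set ((k, l) # L) \<or> LT_multiple G (var i + s)"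
      using queue s unfolding queue_inv_def by blast
    then consider "var i + s \<in> set S" | "var i + s = t" | "var i + s \<in> pair_term S ` set L"
      | "LT_multiple G (var i + s)" by (auto simp: t_def)
    then show "var i + s \<in> set S \<union> pair_term S ` set L' \<or> LT_multiple G' (var i + s)"
    proof cases
      \<comment> \<open>The product taken from the head of the queue is now covered by the new
        relation, whose leading term it is.\<close>
      case 2
      then show ?thesis by (simp add: G'_eq LT_multiple_append LT_g)
    next
      case 3
      then show ?thesis using L'(3) by blast
    qed (auto simp: G'_eq LT_multiple_append)
  qed
  then show ?thesis using lin stair' by (simp add: fglm_inv_def)
qed

lemma pair_term_append: "snd p < length S \<Longrightarrow> pair_term (S @ [t]) p = pair_term S p"
  by (simp add: pair_term_def nth_append)

lemma set_mset_new_pairs: "set_mset (new_pairs r :: ('n \<times> nat) multiset) = range (\<lambda>i. (i, r))"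
  by (simp add: new_pairs_def)

lemma independent_step_inv:
  assumes inv: "fglm_inv (S, V, G, P, (k, l) # L)"
    and v: "v = M k *\<^sub>v (V ! l)" and lam: "lam = P *\<^sub>v v"
    and ex: "\<exists>i. length S \<le> i \<and> i < D \<and> lam $ i \<noteq> 0"
    and S': "S' = S @ [pair_term S (k, l)]"
    and arr: "sorted_arrangement lt S' (mset L + new_pairs (length S)) L1"
    and clean: "cleaned lt S' G L1 L'"
  shows "fglm_inv (S', V @ [v], G, fglm_update P (length S) lam, L')"
proof -
  define t where "t = pair_term S (k, l)"
  have S'_eq: "S' = S @ [t]" by (simp add: S' t_def)
  have lin: "lin_inv S V P" and stair: "stair_inv S G" and queue: "queue_inv S G ((k, l) # L)"
    using inv by (simp_all add: fglm_inv_def)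
  have l: "l < length S" and St: "\<And>s. s \<in> set S \<Longrightarrow> lt s t" and tG: "\<not> LT_multiple G t"
    using queue by (auto simp: queue_inv_def t_def)
  have lin': "lin_inv S' (V @ [v]) (fglm_update P (length S) lam)"
    unfolding S'_eq t_def lam v
    by (rule lin_inv_append[OF lin inv_cong_product[OF lin l] ex[unfolded lam v]])
  have stair': "stair_inv S' G"
    using stair St tG unfolding stair_inv_def S'_eq by (auto simp: sorted_wrt_append)
  have sorted_L1: "sorted_wrt le (map (pair_term S') L1)"
    and "set_mset (mset L1) = set_mset (mset L + new_pairs (length S))"
    using arr by (simp_all add: sorted_arrangement_def)
  then have set_L1: "set L1 = set L \<union> range (\<lambda>i. (i, length S))"
    by (simp add: set_mset_new_pairs)
  have old: "pair_term S' p = pair_term S p" "lt t (pair_term S p)" "snd p < length S"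
    if "p \<in> set L" for p
    using that queue unfolding queue_inv_def S'_eq
    by (auto simp: t_def pair_term_append)
  \<comment> \<open>Indices count from 0, so \<open>length S\<close> points to the appended entry
    \<open>t\<close>.\<close>
  have new: "pair_term S' (i, length S) = var i + t" for i
    by (simp add: pair_term_def S'_eq)
  \<comment> \<open>The queue was strictly sorted, so its remaining terms exceed the head
    \<open>t\<close>; the new terms are proper multiples of \<open>t\<close>.\<close>
  have gt_t: "lt t (pair_term S' p)" if "p \<in> set L1" for p
  proof (cases "p \<in> set L")
    case False
    then show ?thesis using that less_var_add by (auto simp: set_L1 new)
  qed (simp add: old)
  note L' = cleaned_queue[OF clean sorted_L1]
  have "queue_inv S' G L'"
    unfolding queue_inv_def
  proof (intro conjI ballI allI)
    show "sorted_wrt lt (map (pair_term S') L')" by (rule L')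
    fix p assume p: "p \<in> set L'"
    then have p1: "p \<in> set L1" using L'(2) by auto
    then show "snd p < length S'" using old(3)[of p] by (auto simp: set_L1 S'_eq less_Suc_eq)
    show "\<not> LT_multiple G (pair_term S' p)" using L'(3) p by blast
    fix s assume "s \<in> set S'"
    then have "s = t \<or> lt s t" using St by (auto simp: S'_eq)
    then show "lt s (pair_term S' p)" using gt_t[OF p1] lt_trans by blast
  next
    fix s i assume "s \<in> set S'"
    then consider "s = t" | "s \<in> set S" by (auto simp: S'_eq)
    then have "var i + s \<in> set S' \<union> pair_term S' ` set L1 \<or> LT_multiple G (var i + s)"
    proof cases
      case 1
      then have "var i + s = pair_term S' (i, length S)" by (simp add: new)
      then show ?thesis by (auto simp: set_L1)
    next
      case 2
      then have "var i + s \<in> set S \<union> pair_term S ` set ((k, l) # L) \<or> LT_multiple G (var i + s)"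
        using queue unfolding queue_inv_def by blast
      moreover have "pair_term S ` set L \<subseteq> pair_term S' ` set L1"
        using old(1) by (force simp: set_L1)
      ultimately show ?thesis by (auto simp: S'_eq t_def)
    qed
    then show "var i + s \<in> set S' \<union> pair_term S' ` set L' \<or> LT_multiple G (var i + s)"
      using L'(3) by blast
  qed
  then show ?thesis using lin' stair' by (simp add: fglm_inv_def)
qed

lemma step_inv:
  assumes "fglm_inv st" "fglm_step lt M D st st'"
  shows "fglm_inv st'"
  using assms(2)
proof cases
  case (new_relation r S v k V l lam P G' G L L')
  have "fglm_inv (S, V, G', P, L')"
  proof (rule relation_step_inv)
    show "fglm_inv (S, V, G, P, (k, l) # L)" using assms(1) new_relation(1) by simp
    show "lam = P *\<^sub>v (M k *\<^sub>v (V ! l))" using new_relation by blast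
  qed (use new_relation in blast)+
  then show ?thesis using new_relation by simp
next
  case (new_independent r S v k V l lam P S' L L1 G L')
  have "fglm_inv (S', V @ [v], G, fglm_update P (length S) lam, L')"
  proof (rule independent_step_inv)
    show "fglm_inv (S, V, G, P, (k, l) # L)" using assms(1) new_independent(1) by simp
  qed (use new_independent in blast)+
  then show ?thesis using new_independent by simp
qed

lemma init_inv:
  assumes "fglm_init lt D st"
  shows "fglm_inv st"
proof -
  obtain L where L: "sorted_arrangement lt [0] (new_pairs 0) L"
    and st: "st = ([0], [unit_vec D 0], [], 1\<^sub>m D, L)"
    using assms by (auto simp: fglm_init_def)
  have mset_L: "mset L = new_pairs 0" and sorted_L: "sorted_wrt le (map (pair_term [0]) L)"
    using L by (simp_all add: sorted_arrangement_def)
  have set_L: "set L = range (\<lambda>i. (i, 0))"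
    using arg_cong[OF mset_L, of set_mset] by (simp add: set_mset_new_pairs)
  have pt: "pair_term [0] (i, 0) = var i" for i :: 'n
    by (simp add: pair_term_def)
  \<comment> \<open>The initial queue is sorted but has not been cleaned. Its strict order comes
    from the variables being distinct terms, and comparing multisets carries this over to whichever
    arrangement was chosen.\<close>
  have "mset (map (pair_term [0]) L) = image_mset var (mset_set (UNIV :: 'n set))"
    by (simp add: mset_L new_pairs_def image_mset.compositionality o_def pt)
  moreover have "inj (var :: 'n \<Rightarrow> 'n pp)"
    by (auto simp: inj_on_def var_def poly_mapping_eq_iff fun_eq_iff lookup_single when_def
        split: if_splits)
  ultimately have "mset (map (pair_term [0]) L) = mset_set (range var)"
    by (simp add: image_mset_mset_set)
  moreover obtain ts where ts: "set ts = range (var :: 'n \<Rightarrow> 'n pp)" "List.distinct ts"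
    using finite_distinct_list[of "range (var :: 'n \<Rightarrow> 'n pp)"] by auto
  ultimately have "mset (map (pair_term [0]) L) = mset ts"
    using mset_set_set[OF ts(2)] by simp
  then have "List.distinct (map (pair_term [0]) L)"
    using mset_eq_imp_distinct_iff ts(2) by blast
  then have sorted_L': "sorted_wrt lt (map (pair_term [0]) L)"
    by (rule sorted_wrt_le_distinct_imp_lt[OF sorted_L])
  have D: "0 < D" using ws_0(1) by simp
  have "lin_inv [0] [unit_vec D 0] (1\<^sub>m D)"
    using D by (auto simp: lin_inv_def Suc_le_eq mono_poly_0 simp del: length_greater_0_conv)
  moreover have "stair_inv [0] []"
    by (simp add: stair_inv_def LT_multiple_def)
  moreover have "queue_inv [0] [] L"
    using sorted_L' less_var_add[of 0]
    by (auto simp: queue_inv_def LT_multiple_def set_L pt image_image)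
  ultimately show ?thesis by (simp add: fglm_inv_def st)
qed

lemma reachable_inv:
  assumes "fglm_init lt D st" "(fglm_step lt M D)\<^sup>*\<^sup>* st st'"
  shows "fglm_inv st'"
  using assms(2) by (induction rule: rtranclp_induct) (auto intro: init_inv[OF assms(1)] step_inv)

end

section \<open>Correctness and termination\<close>

context proper_poly_ideal
begin

text \<open>No rewriting by G is meant, only the existence of a congruent polynomial with terms in
  \<open>A\<close>; this makes the property stable under linear combinations.\<close>

definition reducible_to :: "'n pp set \<Rightarrow> ('n, 'k) mpoly \<Rightarrow> bool" where
  "reducible_to A f \<longleftrightarrow> (\<exists>h. Poly_Mapping.keys h \<subseteq> A \<and> f \<approx>\<^sub>I h)"

lemma reducible_to_mono: "reducible_to A f \<Longrightarrow> A \<subseteq> B \<Longrightarrow> reducible_to B f"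
  unfolding reducible_to_def by blast

lemma reducible_to_cong: "f \<approx>\<^sub>I g \<Longrightarrow> reducible_to A g \<Longrightarrow> reducible_to A f"
  unfolding reducible_to_def using cong_trans by blast

lemma reducible_to_zero: "reducible_to A 0"
  unfolding reducible_to_def by (intro exI[of _ 0]) simp

lemma reducible_to_add:
  assumes "reducible_to A f" "reducible_to A g"
  shows "reducible_to A (f + g)"
proof -
  obtain h h' where h: "Poly_Mapping.keys h \<subseteq> A" "f \<approx>\<^sub>I h" "Poly_Mapping.keys h' \<subseteq> A" "g \<approx>\<^sub>I h'"
    using assms unfolding reducible_to_def by blast
  then have "Poly_Mapping.keys (h + h') \<subseteq> A"
    using keys_add[of h h'] by blast
  then show ?thesis using cong_add h unfolding reducible_to_def by blast
qed

lemma reducible_to_scale: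
  assumes "reducible_to A f"
  shows "reducible_to A (Poly_Mapping.single 0 c * f)"
proof -
  obtain h where h: "Poly_Mapping.keys h \<subseteq> A" "f \<approx>\<^sub>I h"
    using assms unfolding reducible_to_def by blast
  have "Poly_Mapping.keys (Poly_Mapping.single 0 c * h) \<subseteq> A"
    using keys_mult[of "Poly_Mapping.single 0 c" h] h(1) by (auto split: if_splits)
  then show ?thesis using cong_mult h unfolding reducible_to_def by blast
qed

lemma reducible_to_sum: "(\<And>x. x \<in> J \<Longrightarrow> reducible_to A (f x)) \<Longrightarrow> reducible_to A (sum f J)"
  by (induction J rule: infinite_finite_induct) (auto intro: reducible_to_zero reducible_to_add)

end

context fglm
begin

definition below :: "'n pp list \<Rightarrow> 'n pp \<Rightarrow> 'n pp set" where
  "below S u = {s \<in> set S. le s u}"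

lemma below_mono: "le u v \<Longrightarrow> below S u \<subseteq> below S v"
  unfolding below_def using lt_trans by blast

text \<open>Multiplying the representative of \<open>u\<close> by \<open>x_i\<close> leaves products
  \<open>x_i s\<close> with \<open>s\<close> at most \<open>u\<close>; by compatibility of the
  order, their representatives have no terms beyond \<open>x_i u\<close>.\<close>

lemma reducible_var_mult:
  assumes u: "mono_poly u \<approx>\<^sub>I h" "Poly_Mapping.keys h \<subseteq> below S u"
    and red: "\<And>s. s \<in> Poly_Mapping.keys h \<Longrightarrow>
      reducible_to (below S (var i + s)) (mono_poly (var i + s))"
  shows "reducible_to (below S (var i + u)) (mono_poly (var i + u))"
proof (rule reducible_to_cong)
  show "mono_poly (var i + u) \<approx>\<^sub>I mono_poly (var i) * h"
    using cong_mult[OF u(1), of "mono_poly (var i)"] by simp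
  have "mono_poly (var i) * h = mono_poly (var i) *
      (\<Sum>s\<in>Poly_Mapping.keys h. Poly_Mapping.single s (Poly_Mapping.lookup h s))"
    using poly_mapping_sum_single[of h] by simp
  also have "\<dots> = (\<Sum>s\<in>Poly_Mapping.keys h.
      Poly_Mapping.single 0 (Poly_Mapping.lookup h s) * mono_poly (var i + s))"
    by (simp add: sum_distrib_left mono_poly_def mult_single)
  finally have eq: "mono_poly (var i) * h = \<dots>" .
  show "reducible_to (below S (var i + u)) (mono_poly (var i) * h)"
    unfolding eq
  proof (intro reducible_to_sum reducible_to_scale)
    fix s assume s: "s \<in> Poly_Mapping.keys h"
    then have "le s u" using u(2) by (auto simp: below_def)
    then have "le (var i + s) (var i + u)" by (rule add_mono_le)
    then show "reducible_to (below S (var i + u)) (mono_poly (var i + s))"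
      using red[OF s] reducible_to_mono below_mono by blast
  qed
qed

lemma final_cover:
  assumes "fglm_inv (S, V, G, P, [])"
  shows "t \<in> set S \<or> LT_multiple G t"
proof (induction t rule: pp_induct)
  case zero
  show ?case using assms by (simp add: fglm_inv_def stair_inv_def)
next
  case (var i t)
  have "var i + s \<in> set S \<or> LT_multiple G (var i + s)" if "s \<in> set S" for s i
    using assms that by (auto simp: fglm_inv_def queue_inv_def)
  then show ?case using var LT_multiple_add by blast
qed

text \<open>Well-foundedness of the term order is only needed on the finitely many products of a
  variable and an element of S, so Dickson's lemma is avoided.\<close>

lemma border_reducible:
  assumes inv: "fglm_inv (S, V, G, P, [])" and s: "s \<in> set S"
  shows "reducible_to (below S (var i + s)) (mono_poly (var i + s))"
  using s
proof (induction "card {(j, s'). s' \<in> set S \<and> lt (var j + s') (var i + s)}"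
    arbitrary: i s rule: less_induct)
  case less
  \<comment> \<open>The measure counts the products of a variable and an entry of \<open>S\<close>
    that lie below the given one. It drops since \<open>(j, s')\<close> is counted for the larger
    product but not for its own.\<close>
  let ?B = "\<lambda>b. {(j, s'). s' \<in> set S \<and> lt (var j + s') b}"
  have IH: "reducible_to (below S (var j + s')) (mono_poly (var j + s'))"
    if s': "s' \<in> set S" and lt: "lt (var j + s') (var i + s)" for j s'
  proof (rule less.hyps[OF _ s'])
    have "?B (var j + s') \<subset> ?B (var i + s)"
      using s' lt lt_trans lt_irrefl by blast
    moreover have "finite (?B (var i + s))"
      by (rule finite_subset[of _ "UNIV \<times> set S"]) auto
    ultimately show "card (?B (var j + s')) < card (?B (var i + s))"
      by (intro psubset_card_mono)
  qed
  \<comment> \<open>A divisor outside \<open>S\<close> would be a multiple of a leading term, and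
    then so would the entry of \<open>S\<close> that it divides.\<close>
  have S_div: "v \<in> set S" if "u + v \<in> set S" for u v
    using final_cover[OF inv, of v] LT_multiple_add that inv
    by (auto simp: fglm_inv_def stair_inv_def)
  show ?case
  proof (cases "var i + s \<in> set S")
    case True
    then show ?thesis
      unfolding reducible_to_def
      by (intro exI[of _ "mono_poly (var i + s)"]) (auto simp: mono_poly_def below_def)
  next
    case False
    then have "LT_multiple G (var i + s)" using final_cover[OF inv] by blast
    then obtain g m where g: "g \<in> set G" and m: "var i + s = LT lt g + m"
      unfolding LT_multiple_def term_dvd_def by blast
    have gI: "g \<in> I" and g1: "Poly_Mapping.lookup g (LT lt g) = 1"
      and g_keys: "Poly_Mapping.keys g \<subseteq> insert (LT lt g) (set S)"
      using inv g by (auto simp: fglm_inv_def stair_inv_def)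
    show ?thesis
    proof (cases m rule: pp_cases)
      case zero
      then have LT: "LT lt g = var i + s" using m by simp
      \<comment> \<open>Here the product is itself a leading term, and \<open>h\<close> is the
        negative of the remaining part of the monic relation \<open>g\<close>.\<close>
      define h where "h = mono_poly (var i + s) - g"
      have h0: "Poly_Mapping.lookup h (var i + s) = 0"
        using g1 by (simp add: h_def lookup_minus lookup_mono_poly LT)
      have "Poly_Mapping.keys h \<subseteq> insert (var i + s) (Poly_Mapping.keys g)"
        using keys_diff[of "mono_poly (var i + s)" g] by (auto simp: h_def mono_poly_def)
      moreover have "var i + s \<notin> Poly_Mapping.keys h" using h0 by (simp add: in_keys_iff)
      moreover have "le u (var i + s)" if "u \<in> Poly_Mapping.keys g" for u
        using LT_greatest(2)[of g u] that LT by force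
      ultimately have "Poly_Mapping.keys h \<subseteq> below S (var i + s)"
        using g_keys LT by (auto simp: below_def)
      moreover have "mono_poly (var i + s) \<approx>\<^sub>I h"
        using gI by (simp add: cong_def h_def)
      ultimately show ?thesis unfolding reducible_to_def by blast
    next
      case (var j m')
      then have b: "var i + s = var j + (LT lt g + m')" using m by (simp add: add.left_commute)
      \<comment> \<open>The quotient of \<open>x_i s\<close> by \<open>x_j\<close> is a multiple of
        \<open>LT(g)\<close>, which the entry \<open>s\<close> of \<open>S\<close> is not, so
        \<open>x_j\<close> differs from \<open>x_i\<close> and must divide \<open>s\<close>. The
        quotient is then \<open>x_i s'\<close> with \<open>s'\<close> in \<open>S\<close>, a smaller
        product of the same kind.\<close>
      have "i \<noteq> j"
      proof
        assume "i = j"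
        then have "s = LT lt g + m'" using b by simp
        then have "LT_multiple G s" using g unfolding LT_multiple_def term_dvd_def by blast
        then show False using inv less.prems by (auto simp: fglm_inv_def stair_inv_def)
      qed
      with b obtain s' where s': "s = var j + s'" and c: "LT lt g + m' = var i + s'"
        by (rule var_add_swap)
      have s'S: "s' \<in> set S" using S_div less.prems s' by blast
      have bc: "var i + s = var j + (var i + s')" using b c by simp
      have "reducible_to (below S (var i + s')) (mono_poly (var i + s'))"
        by (rule IH[OF s'S]) (use less_var_add bc in simp)
      then obtain h where h: "Poly_Mapping.keys h \<subseteq> below S (var i + s')" "mono_poly (var i + s') \<approx>\<^sub>I h"
        unfolding reducible_to_def by blast
      have "LT_multiple G (var i + s')"
        using g c unfolding LT_multiple_def term_dvd_def by metis
      \<comment> \<open>Since \<open>x_i s'\<close> lies outside \<open>S\<close>, the terms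
        \<open>u\<close> of its representative are strictly smaller. So each \<open>x_j u\<close> is
        strictly below \<open>x_j x_i s'\<close>, the product at hand, as the second use of the
        induction hypothesis demands.\<close>
      then have c_notin: "var i + s' \<notin> set S"
        using inv by (auto simp: fglm_inv_def stair_inv_def)
      show ?thesis
        unfolding bc
      proof (rule reducible_var_mult[OF h(2,1)])
        fix u assume "u \<in> Poly_Mapping.keys h"
        then have u: "u \<in> set S" "lt u (var i + s')"
          using h(1) c_notin by (auto simp: below_def)
        show "reducible_to (below S (var j + u)) (mono_poly (var j + u))"
          by (rule IH[OF u(1)]) (use add_mono[OF u(2)] bc in simp)
      qed
    qed
  qed
qed

text \<open>The representative of \<open>t\<close> has its terms in \<open>S\<close>, so multiplying
  it by a variable creates only products already treated in \<open>border_reducible\<close>.\<close>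

lemma term_reducible:
  assumes inv: "fglm_inv (S, V, G, P, [])"
  shows "reducible_to (below S t) (mono_poly t)"
proof (induction t rule: pp_induct)
  case zero
  have "0 \<in> set S" using inv by (simp add: fglm_inv_def stair_inv_def)
  then show ?case
    unfolding reducible_to_def
    by (intro exI[of _ "mono_poly 0"]) (auto simp: mono_poly_def below_def)
next
  case (var i t)
  then obtain h where h: "Poly_Mapping.keys h \<subseteq> below S t" "mono_poly t \<approx>\<^sub>I h"
    unfolding reducible_to_def by blast
  show ?case
    by (rule reducible_var_mult[OF h(2,1)])
      (use h(1) border_reducible[OF inv] in \<open>auto simp: below_def\<close>)
qed

lemma final_LT_multiple:
  assumes inv: "fglm_inv (S, V, G, P, [])" and f: "f \<in> I" "f \<noteq> 0"
  shows "LT_multiple G (LT lt f)"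
proof (rule ccontr)
  let ?t = "LT lt f"
  assume "\<not> LT_multiple G ?t"
  then have tS: "?t \<in> set S" using final_cover[OF inv] by blast
  let ?c = "\<lambda>u. Poly_Mapping.single 0 (Poly_Mapping.lookup f u)"
  let ?T = "Poly_Mapping.keys f - {?t}"
  define A where "A = {s \<in> set S. lt s ?t}"
  have t_key: "?t \<in> Poly_Mapping.keys f" by (rule LT_greatest(1)[OF f(2)])
  have "f = (\<Sum>u\<in>Poly_Mapping.keys f. ?c u * mono_poly u)"
    unfolding single_eq_const_mult_mono[symmetric] by (rule poly_mapping_sum_single)
  also have "\<dots> = ?c ?t * mono_poly ?t + (\<Sum>u\<in>?T. ?c u * mono_poly u)"
    by (rule sum.remove[OF finite_keys t_key])
  finally have f_eq: "f = \<dots>" .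
  have "reducible_to A (\<Sum>u\<in>?T. ?c u * mono_poly u)"
  proof (intro reducible_to_sum reducible_to_scale)
    fix u assume "u \<in> ?T"
    then have "lt u ?t" using LT_greatest(2)[OF f(2), of u] by blast
    then have "below S u \<subseteq> A" unfolding below_def A_def using lt_trans by blast
    then show "reducible_to A (mono_poly u)"
      using term_reducible[OF inv] reducible_to_mono by blast
  qed
  then obtain h where h: "Poly_Mapping.keys h \<subseteq> A" "(\<Sum>u\<in>?T. ?c u * mono_poly u) \<approx>\<^sub>I h"
    unfolding reducible_to_def by blast
  \<comment> \<open>\<open>q\<close> lies in \<open>I\<close>, has its terms in \<open>S\<close> and
    keeps the nonzero leading coefficient of \<open>f\<close>, against the independence of
    \<open>S\<close>.\<close>
  define q where "q = ?c ?t * mono_poly ?t + h"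
  have "f \<approx>\<^sub>I q" using cong_add[OF cong_refl h(2), of "?c ?t * mono_poly ?t"] f_eq
    by (simp add: q_def)
  then have qI: "q \<in> I" using f(1) cong_sym cong_trans cong_zero_iff by blast
  have q_single: "q = Poly_Mapping.single ?t (Poly_Mapping.lookup f ?t) + h"
    by (simp add: q_def single_eq_const_mult_mono[symmetric])
  have q_keys: "Poly_Mapping.keys q \<subseteq> set S"
    using keys_add[of "Poly_Mapping.single ?t (Poly_Mapping.lookup f ?t)" h] h(1) tS
    by (auto simp: q_single A_def split: if_splits)
  have dist: "List.distinct S"
    using inv by (intro sorted_wrt_imp_distinct) (simp add: fglm_inv_def stair_inv_def)
  obtain i where i: "i < length S" "S ! i = ?t" using tS by (auto simp: in_set_conv_nth)
  have "Poly_Mapping.lookup q (S ! i) = 0"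
  proof (rule term_comb_in_I_imp_0[OF _ _ i(1)])
    show "lin_inv S V P" using inv by (simp add: fglm_inv_def)
    show "term_comb S (\<lambda>i. Poly_Mapping.lookup q (S ! i)) \<in> I"
      using term_comb_lookup[OF dist q_keys] qI by simp
  qed
  moreover have "Poly_Mapping.lookup h ?t = 0"
    using h(1) by (auto simp: A_def simp flip: not_in_keys_iff_lookup_eq_zero)
  ultimately have "Poly_Mapping.lookup f ?t = 0"
    by (simp add: i(2) q_single lookup_add)
  then show False using t_key by (simp add: in_keys_iff)
qed

lemma final_groebner_basis:
  assumes inv: "fglm_inv (S, V, G, P, [])"
  shows "groebner_basis lt I (set G)"
proof -
  have G: "g \<in> I" "g \<noteq> 0" if "g \<in> set G" for g
    using inv that by (auto simp: fglm_inv_def stair_inv_def)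
  have "LT_ideal lt (set G) = LT_ideal lt I"
    by (rule LT_ideal_eqI) (use G final_LT_multiple[OF inv] in \<open>auto simp: LT_multiple_def\<close>)
  then show ?thesis using G by (auto simp: groebner_basis_def)
qed

section \<open>Termination of the loop\<close>

lemma step_decreases:
  assumes "fglm_step lt M D st st'"
  shows "(st', st) \<in> measures [\<lambda>(S, V, G, P, L). D - length S, \<lambda>(S, V, G, P, L). length L]"
  using assms
proof cases
  case (new_relation r S v k V l lam P G' G L L')
  then have "subseq L' L" by (simp add: cleaned_def)
  then show ?thesis using new_relation list_emb_length[of "(=)" L' L] by auto
next
  \<comment> \<open>A nonzero entry at a position \<open>i\<close> with \<open>r <= i < D\<close>
    forces \<open>length S < D\<close>, so the truncated difference really drops, however much the
    queue grows.\<close>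
  case (new_independent r S v k V l lam P S' L L1 G L')
  then show ?thesis by auto
qed

lemma terminates: "fglm_terminates lt M D"
  unfolding fglm_terminates_def
proof (intro conjI allI impI)
  show "\<exists>st :: ('n, 'k) fglm_state. fglm_init lt D st"
    using ex_sorted_arrangement unfolding fglm_init_def by blast
  show "\<not> (\<exists>\<sigma>. fglm_init lt D (\<sigma> 0) \<and> (\<forall>i. fglm_step lt M D (\<sigma> i) (\<sigma> (Suc i))))"
  proof
    assume "\<exists>\<sigma>. fglm_init lt D (\<sigma> 0) \<and> (\<forall>i. fglm_step lt M D (\<sigma> i) (\<sigma> (Suc i)))"
    then obtain \<sigma> where \<sigma>: "fglm_init lt D (\<sigma> 0)" "\<And>i. fglm_step lt M D (\<sigma> i) (\<sigma> (Suc i))"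
      by blast
    have "\<forall>i. (\<sigma> (Suc i), \<sigma> i) \<in>
        measures [\<lambda>(S, V, G, P, L). D - length S, \<lambda>(S, V, G, P, L). length L]"
      using step_decreases \<sigma>(2) by blast
    then show False using wf_measures wf_iff_no_infinite_down_chain by blast
  qed
next
  fix st S V G P and L :: "('n \<times> nat) list"
  assume "fglm_init lt D st \<and> (fglm_step lt M D)\<^sup>*\<^sup>* st (S, V, G, P, L) \<and> L \<noteq> []"
  then obtain k l L0 where L: "L = (k, l) # L0" by (metis list.exhaust surj_pair)
  let ?lam = "P *\<^sub>v (M k *\<^sub>v (V ! l))"
  show "\<exists>st'. fglm_step lt M D (S, V, G, P, L) st'"
  \<comment> \<open>The conditions of the two rules are complementary, and sorting and cleaning
    always have a result, so a nonempty queue never blocks.\<close>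
  proof (cases "\<exists>i. length S \<le> i \<and> i < D \<and> ?lam $ i \<noteq> 0")
    case True
    let ?S' = "S @ [pair_term S (k, l)]"
    obtain L1 where L1: "sorted_arrangement lt ?S' (mset L0 + new_pairs (length S)) L1"
      using ex_sorted_arrangement by blast
    obtain L' where clean: "cleaned lt ?S' G L1 L'" using ex_cleaned by blast
    have "fglm_step lt M D (S, V, G, P, (k, l) # L0)
        (?S', V @ [M k *\<^sub>v (V ! l)], G, fglm_update P (length S) ?lam, L')"
      by (rule fglm_step.new_independent) (rule refl True L1 clean)+
    then show ?thesis unfolding L by blast
  next
    case False
    then have zero: "\<forall>i. length S \<le> i \<and> i < D \<longrightarrow> ?lam $ i = 0" by blast
    let ?G' = "G @ [mono_poly (pair_term S (k, l)) -
      (\<Sum>i<length S. Poly_Mapping.single (S ! i) (?lam $ i))]"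
    obtain L' where clean: "cleaned lt S ?G' L0 L'" using ex_cleaned by blast
    have "fglm_step lt M D (S, V, G, P, (k, l) # L0) (S, V, ?G', P, L')"
      by (rule fglm_step.new_relation) (rule refl zero clean)+
    then show ?thesis unfolding L by blast
  qed
qed

lemma returns_groebner_basis: "fglm_returns lt M D G \<Longrightarrow> groebner_basis lt I (set G)"
  unfolding fglm_returns_def using reachable_inv final_groebner_basis by blast

end

theorem theorem2p11:
  fixes I G1 :: "('n::finite, 'k::field) mpoly set"
    and lt1 lt2 :: "'n pp \<Rightarrow> 'n pp \<Rightarrow> bool"
    and ws :: "'n pp list"
    and M :: "'n \<Rightarrow> 'k mat"
    and D :: nat
  assumes "ideal I polyring"
    and "I \<subset> UNIV"
    and "zero_dimensional I"
    and "D = quot_dim I"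
    and "term_order lt1"
    and "term_order lt2"
    and "reduced_groebner_basis lt1 I G1"
    and "staircase_list lt1 G1 ws"
    and "\<And>k. mult_matrix I ws k (M k)"
  shows "fglm_terminates lt2 M D \<and>
         (\<forall>G. fglm_returns lt2 M D G \<longrightarrow> groebner_basis lt2 I (set G))"
proof -
  interpret proper_poly_ideal I by (rule proper_poly_ideal.intro) (rule assms)+
  have ord1: "term_ord lt1" by (rule term_ord.intro) (rule assms)
  have gb: "groebner_basis lt1 I G1" "0 \<notin> G1"
    using assms(7) by (auto simp: reduced_groebner_basis_def)
  have sorted: "sorted_wrt lt1 ws" and set_ws: "set ws = staircase lt1 G1"
    using assms(8) by (auto simp: staircase_list_def)
  have dist: "List.distinct ws" by (rule term_ord.sorted_wrt_imp_distinct[OF ord1 sorted])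
  have zero: "0 \<in> set ws" using zero_in_staircase[OF gb(1) ord1 gb(2)] set_ws by simp
  interpret fglm I ws M lt2
  proof
    show "term_order lt2" by (rule assms)
    show "ws \<noteq> []" using zero by auto
    \<comment> \<open>The term 1 occurs in the sorted list and is the least of all terms.\<close>
    show "ws ! 0 = 0"
    proof (rule ccontr)
      assume neq: "ws ! 0 \<noteq> 0"
      obtain i where i: "i < length ws" "ws ! i = 0" using zero by (auto simp: in_set_conv_nth)
      then have "lt1 (ws ! 0) 0"
        using neq sorted_wrt_nth_less[OF sorted, of 0 i] by (cases "i = 0") auto
      then show False
        using neq term_ord.zero_le[OF ord1] term_ord.le_antisym[OF ord1] by blast
    qed
    show "mult_matrix I ws k (M k)" for k by (rule assms)
    show "a i = 0" if "term_comb ws a \<in> I" "i < length ws" for a i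
    proof -
      have "term_comb ws a = 0"
        by (rule staircase_independent[OF gb(1) ord1 that(1)]) (use keys_term_comb set_ws in blast)
      then show ?thesis using lookup_term_comb[OF dist that(2), of a] by simp
    qed
  qed
  \<comment> \<open>The given \<open>D\<close> is the dimension of the quotient, which
    \<open>quot_dim\<close> identifies with the length of \<open>ws\<close>.\<close>
  show ?thesis
    using terminates returns_groebner_basis by (simp add: assms(4) quot_dim)
qed

end
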